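(* Let $m\ge 1$, $n\ge 0$ and $k\ge 1$ be integers. Let $L$ be an elliptic (scalar) linear partial differential operator in the variables $x_1,\ldots,x_m$ on $\mathbb{R}^m$, and let $P=L+\Delta_f$, where $\Delta_f=4\sum_{j=1}^n\partial_{\grave{x}_{2j-1}}\partial_{\grave{x}_{2j}}$ is the fermionic Laplace operator. Let $\mu_{2l}^{m|0}$, $l=1,2,\ldots$, be a set of fundamental solutions for the operators $L^l$ such that $L^j\mu_{2l}^{m|0}=\mu_{2l-2j}^{m|0}$ for $j<l$ and $L^l\mu_{2l}^{m|0}=\delta(\underline{x})$. Then $$\mu_{2k}^{m|2n}=\sum_{l=0}^n4^l\,\frac{(l+k-1)!}{(n-l)!\,(k-1)!}\,\mu_{2l+2k}^{m|0}\,\underline{\grave{x}}^{2n-2l}$$ is a fundamental solution for the operator $P^k$, i.e. $P^k\mu_{2k}^{m|2n}=\delta(x)$ in the distributional sense.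
   Context: Variables: $x_1,\ldots,x_m$ are commuting real variables (coordinates on $\mathbb{R}^m$); $\grave{x}_1,\ldots,\grave{x}_{2n}$ are anticommuting variables ($\grave{x}_i\grave{x}_j=-\grave{x}_j\grave{x}_i$) generating the real Grassmann algebra $\Lambda_{2n}$; the $x_i$ commute with the $\grave{x}_j$. $\mathcal{C}$ is the real associative unital algebra generated by $e_1,\ldots,e_m,\grave{e}_1,\ldots,\grave{e}_{2n}$ with relations $e_je_k+e_ke_j=-2\delta_{jk}$, $\grave{e}_{2j}\grave{e}_{2k}-\grave{e}_{2k}\grave{e}_{2j}=0$, $\grave{e}_{2j-1}\grave{e}_{2k-1}-\grave{e}_{2k-1}\grave{e}_{2j-1}=0$, $\grave{e}_{2j-1}\grave{e}_{2k}-\grave{e}_{2k}\grave{e}_{2j-1}=\delta_{jk}$, $e_j\grave{e}_k+\grave{e}_ke_j=0$. All $e_i,\grave{e}_j$ commute with all $x_i,\grave{x}_j$. Vector variables: $\underline{x}=\sum_{i=1}^m x_ie_i$, $\underline{\grave{x}}=\sum_{j=1}^{2n}\grave{x}_j\grave{e}_j$, $x=\underline{x}+\underline{\grave{x}}$. One has $\underline{\grave{x}}^2=\sum_{j=1}^n\grave{x}_{2j-1}\grave{x}_{2j}$, and $\underline{\grave{x}}^0=1$. Operators: $\partial_{\grave{x}_j}$ is the left derivative on the Grassmann algebra ($\partial_{\grave{x}_j}(\grave{x}_kF)=\delta_{jk}F-\grave{x}_k\partial_{\grave{x}_j}F$), commuting with the $x_i$, $e_i$, $\grave{e}_i$ and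 $\partial_{x_i}$. The operator $L$ acts only on the first tensor factor of $\mathcal{D}'(\mathbb{R}^m)\otimes\Lambda_{2n}\otimes\mathcal{C}$ (in the distributional sense), hence commutes with $\Delta_f$. (Example: $L=-\sum_j\partial_{x_j}^2-\lambda^2$, $\lambda\in\mathbb{R}$, for which $P$ is the super Helmholtz operator.) Distributions: $\delta(\underline{x})$ is the Dirac distribution at the origin of $\mathbb{R}^m$, and the super Dirac distribution is $\delta(x)=\delta(\underline{x})\,\grave{x}_1\cdots\grave{x}_{2n}=\delta(\underline{x})\,\underline{\grave{x}}^{2n}/n!$. *)

theory Defs
  imports "HOL-Analysis.Analysis" "HOL-Library.Poly_Mapping"
begin

section \<open>Smooth functions and test functions on Euclidean space\<close>

definition partial_deriv :: "'m \<Rightarrow> (real ^ 'm \<Rightarrow> real) \<Rightarrow> real ^ 'm \<Rightarrow> real"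
  where "partial_deriv i f = (\<lambda>x. frechet_derivative f (at x) (axis i 1))"

text \<open>Iterated partial derivatives are indexed by words:
  the word \<open>[i1, \<dots>, ir]\<close> stands for the composition of the partial derivatives in the
  directions \<open>i1, \<dots>, ir\<close>. This avoids choosing an order of the coordinates, which
  multi-indices would require.\<close>

definition partial_derivs :: "'m list \<Rightarrow> (real ^ 'm \<Rightarrow> real) \<Rightarrow> real ^ 'm \<Rightarrow> real"
  where "partial_derivs w f = foldr partial_deriv w f"

definition smooth :: "(real ^ 'm \<Rightarrow> real) \<Rightarrow> bool"
  where "smooth f \<longleftrightarrow> (\<forall>w x. partial_derivs w f differentiable (at x))"

definition support :: "(real ^ 'm \<Rightarrow> real) \<Rightarrow> (real ^ 'm) set"
  where "support f = closure {x. f x \<noteq> 0}"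

lemma smooth_differentiable: "smooth f \<Longrightarrow> f differentiable (at x)"
  unfolding smooth_def partial_derivs_def by (metis foldr.simps(1) id_apply)

lemma smooth_partial_deriv:
  assumes "smooth f" shows "smooth (partial_deriv i f)"
proof -
  have "partial_derivs w (partial_deriv i f) = partial_derivs (w @ [i]) f" for w
    by (simp add: partial_derivs_def)
  with assms show ?thesis by (simp add: smooth_def)
qed

lemma partial_derivs_const: "\<exists>d. partial_derivs w (\<lambda>x. c) = (\<lambda>x. d)"
  by (induction w) (auto simp: partial_derivs_def partial_deriv_def)

lemma smooth_const: "smooth (\<lambda>x. c)"
  unfolding smooth_def
proof (intro allI)
  fix w :: "'a list" and x :: "real ^ 'a"
  obtain d where "partial_derivs w (\<lambda>x :: real ^ 'a. c) = (\<lambda>x. d)"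
    using partial_derivs_const by blast
  then show "partial_derivs w (\<lambda>x. c) differentiable (at x)" by simp
qed

lemma partial_deriv_eq:
  assumes "(f has_derivative D) (at x)" shows "partial_deriv i f x = D (axis i 1)"
  by (simp add: partial_deriv_def frechet_derivative_at[OF assms, symmetric])

lemma partial_deriv_add:
  assumes "f differentiable (at x)" "g differentiable (at x)"
  shows "partial_deriv i (\<lambda>x. f x + g x) x = partial_deriv i f x + partial_deriv i g x"
proof -
  have "((\<lambda>x. f x + g x) has_derivative
      (\<lambda>h. frechet_derivative f (at x) h + frechet_derivative g (at x) h)) (at x)"
    using assms frechet_derivative_works by (blast intro: has_derivative_add)
  from partial_deriv_eq[OF this] show ?thesis by (simp add: partial_deriv_def)
qed

lemma partial_deriv_mult:
  assumes "f differentiable (at x)" "g differentiable (at x)"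
  shows "partial_deriv i (\<lambda>x. f x * g x) x = f x * partial_deriv i g x + partial_deriv i f x * g x"
proof -
  have "((\<lambda>x. f x * g x) has_derivative
      (\<lambda>h. f x * frechet_derivative g (at x) h + frechet_derivative f (at x) h * g x)) (at x)"
    using assms frechet_derivative_works by (blast intro: has_derivative_mult)
  from partial_deriv_eq[OF this] show ?thesis by (simp add: partial_deriv_def)
qed

lemma smooth_add:
  assumes "smooth f" "smooth g" shows "smooth (\<lambda>x. f x + g x)"
proof -
  have eq: "partial_derivs w (\<lambda>x. f x + g x) = (\<lambda>x. partial_derivs w f x + partial_derivs w g x)" for w
  proof (induction w)
    case Nil
    then show ?case by (simp add: partial_derivs_def)
  next
    case (Cons i w)
    have *: "partial_derivs w f differentiable (at x)" "partial_derivs w g differentiable (at x)" for x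
      using assms by (auto simp: smooth_def)
    have "partial_derivs (i # w) (\<lambda>x. f x + g x)
        = partial_deriv i (\<lambda>x. partial_derivs w f x + partial_derivs w g x)"
      by (simp add: partial_derivs_def Cons[unfolded partial_derivs_def])
    also have "\<dots> = (\<lambda>x. partial_deriv i (partial_derivs w f) x + partial_deriv i (partial_derivs w g) x)"
      by (rule ext) (rule partial_deriv_add[OF *])
    finally show ?case by (simp add: partial_derivs_def)
  qed
  show ?thesis
    unfolding smooth_def eq using assms by (auto simp: smooth_def)
qed

lemma smooth_mult:
  assumes "smooth f" "smooth g" shows "smooth (\<lambda>x. f x * g x)"
proof -
  define P where "P h \<longleftrightarrow> (\<exists>ps. (\<forall>p \<in> set ps. smooth (fst p) \<and> smooth (snd p)) \<and>
      h = (\<lambda>x. \<Sum>p\<leftarrow>ps. fst p x * snd p x))" for h :: "real ^ 'a \<Rightarrow> real"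
  have step: "(\<forall>x. h differentiable (at x)) \<and> P (partial_deriv i h)" if Ph: "P h" for h i
  proof -
    obtain ps where ps: "\<forall>p \<in> set ps. smooth (fst p) \<and> smooth (snd p)"
        and h: "h = (\<lambda>x. \<Sum>p\<leftarrow>ps. fst p x * snd p x)"
      using Ph unfolding P_def by blast
    show ?thesis
      unfolding h using ps
    proof (induction ps)
      case Nil
      have "partial_deriv i (\<lambda>x. 0) = (\<lambda>x. \<Sum>p\<leftarrow>[]. fst p x * snd p x)"
        by (simp add: partial_deriv_def)
      moreover have "P (\<lambda>x. \<Sum>p\<leftarrow>[]. fst p x * snd p x)"
        unfolding P_def by (rule exI[of _ "[]"]) simp
      ultimately show ?case by simp
    next
      case (Cons p ps)
      define s where "s = (\<lambda>x. \<Sum>p\<leftarrow>ps. fst p x * snd p x)"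
      have sp: "smooth (fst p)" "smooth (snd p)" using Cons.prems by auto
      then have dp: "fst p differentiable (at x)" "snd p differentiable (at x)" for x
        by (auto intro: smooth_differentiable)
      have ds: "s differentiable (at x)" for x
        unfolding s_def using Cons.IH Cons.prems by simp
      have Ps: "P (partial_deriv i s)"
        unfolding s_def using Cons.IH Cons.prems by simp
      have dm: "(\<lambda>x. fst p x * snd p x) differentiable (at x)" for x
        using dp by (rule differentiable_mult)
      have eq: "partial_deriv i (\<lambda>x. fst p x * snd p x + s x)
          = (\<lambda>x. fst p x * partial_deriv i (snd p) x + partial_deriv i (fst p) x * snd p x
                + partial_deriv i s x)"
        by (rule ext) (simp add: partial_deriv_add[OF dm ds] partial_deriv_mult[OF dp])
      obtain qs where qs: "\<forall>p \<in> set qs. smooth (fst p) \<and> smooth (snd p)"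
          and s': "partial_deriv i s = (\<lambda>x. \<Sum>p\<leftarrow>qs. fst p x * snd p x)"
        using Ps unfolding P_def by blast
      have "P (partial_deriv i (\<lambda>x. fst p x * snd p x + s x))"
        unfolding eq s' P_def
        by (rule exI[of _ "(fst p, partial_deriv i (snd p)) # (partial_deriv i (fst p), snd p) # qs"])
           (use sp qs in \<open>auto intro: smooth_partial_deriv\<close>)
      moreover have "(\<lambda>x. fst p x * snd p x + s x) differentiable (at x)" for x
        using dm ds by (rule differentiable_add)
      ultimately show ?case by (simp add: s_def)
    qed
  qed
  have "P (\<lambda>x. f x * g x)"
    unfolding P_def by (rule exI[of _ "[(f, g)]"]) (use assms in simp)
  then have P: "P (partial_derivs w (\<lambda>x. f x * g x))" for w
  proof (induction w)
    case Nil
    then show ?case by (simp add: partial_derivs_def)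
  next
    case (Cons i w)
    from step[OF Cons.IH[OF Cons.prems], of i] show ?case by (simp add: partial_derivs_def)
  qed
  show ?thesis
    unfolding smooth_def using step[OF P] by blast
qed

lemma support_subset: "{x. f x \<noteq> 0} \<subseteq> support f"
  by (simp add: support_def closure_subset)

lemma compact_support_mono:
  assumes "compact (support f)" "{x. g x \<noteq> 0} \<subseteq> support f" shows "compact (support g)"
proof -
  have "support g \<subseteq> support f"
    using assms(2) unfolding support_def by (simp add: closure_minimal)
  then show ?thesis
    using closed_Int_compact[of "support g" "support f"] assms(1)
    by (simp add: support_def Int_absorb2)
qed

lemma partial_deriv_support: "{x. partial_deriv i f x \<noteq> 0} \<subseteq> support f"
proof (rule subsetI, rule ccontr)
  fix x assume "x \<in> {x. partial_deriv i f x \<noteq> 0}" and x: "x \<notin> support f"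
  have "(f has_derivative (\<lambda>h. 0)) (at x)"
  proof (rule has_derivative_transform_within_open)
    show "((\<lambda>x. 0) has_derivative (\<lambda>h. 0)) (at x)" by simp
    show "open (- support f)" by (simp add: support_def open_Compl)
    show "x \<in> - support f" using x by simp
    show "0 = f y" if "y \<in> - support f" for y
      using that support_subset[of f] by auto
  qed
  from partial_deriv_eq[OF this] have "partial_deriv i f x = 0" .
  with \<open>x \<in> {x. partial_deriv i f x \<noteq> 0}\<close> show False by simp
qed

typedef 'm smooth_fun = "{f :: real ^ 'm::finite \<Rightarrow> real. smooth f}"
  using smooth_const by auto

setup_lifting type_definition_smooth_fun

typedef 'm test_fun = "{f :: real ^ 'm::finite \<Rightarrow> real. smooth f \<and> compact (support f)}"
  by (rule exI[of _ "\<lambda>x. 0"]) (auto simp: support_def smooth_const)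

setup_lifting type_definition_test_fun

instantiation test_fun :: (finite) real_vector
begin

lift_definition zero_test_fun :: "'a test_fun" is "\<lambda>x. 0"
  by (simp add: support_def smooth_const)

lift_definition plus_test_fun :: "'a test_fun \<Rightarrow> 'a test_fun \<Rightarrow> 'a test_fun" is "\<lambda>f g x. f x + g x"
proof -
  fix f g :: "real ^ 'a \<Rightarrow> real"
  assume f: "smooth f \<and> compact (support f)" and g: "smooth g \<and> compact (support g)"
  have "support (\<lambda>x. f x + g x) \<subseteq> support f \<union> support g"
    unfolding support_def closure_Un[symmetric] by (rule closure_mono) auto
  moreover have "closed (support (\<lambda>x. f x + g x))" by (simp add: support_def)
  ultimately have "compact (support (\<lambda>x. f x + g x))"
    using closed_Int_compact[of "support (\<lambda>x. f x + g x)" "support f \<union> support g"] f g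
    by (simp add: compact_Un Int_absorb2)
  with f g show "smooth (\<lambda>x. f x + g x) \<and> compact (support (\<lambda>x. f x + g x))"
    by (simp add: smooth_add)
qed

lift_definition scaleR_test_fun :: "real \<Rightarrow> 'a test_fun \<Rightarrow> 'a test_fun" is "\<lambda>c f x. c * f x"
proof -
  fix c and f :: "real ^ 'a \<Rightarrow> real"
  assume f: "smooth f \<and> compact (support f)"
  then have "compact (support (\<lambda>x. c * f x))"
    using compact_support_mono[of f] support_subset[of f] by (auto simp: subset_iff)
  with f show "smooth (\<lambda>x. c * f x) \<and> compact (support (\<lambda>x. c * f x))"
    by (simp add: smooth_mult smooth_const)
qed

definition uminus_test_fun :: "'a test_fun \<Rightarrow> 'a test_fun" where "- f = (- 1) *\<^sub>R (f :: 'a test_fun)"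

definition minus_test_fun :: "'a test_fun \<Rightarrow> 'a test_fun \<Rightarrow> 'a test_fun"
  where "f - g = f + - (g :: 'a test_fun)"

instance
proof
  fix f g h :: "'a test_fun" and c d :: real
  show "f + g + h = f + (g + h)" "f + g = g + f" "0 + f = f"
    "c *\<^sub>R (f + g) = c *\<^sub>R f + c *\<^sub>R g" "(c + d) *\<^sub>R f = c *\<^sub>R f + d *\<^sub>R f"
    "c *\<^sub>R d *\<^sub>R f = (c * d) *\<^sub>R f" "1 *\<^sub>R f = f"
    by (transfer; simp add: fun_eq_iff algebra_simps)+
  show "- f + f = 0"
    unfolding uminus_test_fun_def by transfer (simp add: fun_eq_iff)
  show "f - g = f + - g" by (simp add: minus_test_fun_def)
qed

end

lift_definition test_deriv :: "'m::finite \<Rightarrow> 'm test_fun \<Rightarrow> 'm test_fun" is partial_deriv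
proof -
  fix i and f :: "real ^ 'm \<Rightarrow> real"
  assume f: "smooth f \<and> compact (support f)"
  show "smooth (partial_deriv i f) \<and> compact (support (partial_deriv i f))"
    using smooth_partial_deriv[of f i] compact_support_mono[OF _ partial_deriv_support, of f i] f
    by simp
qed

lift_definition test_mult :: "'m::finite smooth_fun \<Rightarrow> 'm test_fun \<Rightarrow> 'm test_fun"
  is "\<lambda>a f x. a x * f x"
proof -
  fix a f :: "real ^ 'm \<Rightarrow> real"
  assume a: "smooth a" and f: "smooth f \<and> compact (support f)"
  then have "compact (support (\<lambda>x. a x * f x))"
    using compact_support_mono[of f] support_subset[of f] by (auto simp: subset_iff)
  with a f show "smooth (\<lambda>x. a x * f x) \<and> compact (support (\<lambda>x. a x * f x))"
    by (simp add: smooth_mult)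
qed


section \<open>Distributions and linear partial differential operators\<close>

text \<open>Continuity is expressed by the usual seminorm estimate on every compact set.\<close>

definition distribution :: "('m::finite test_fun \<Rightarrow> real) \<Rightarrow> bool"
  where "distribution T \<longleftrightarrow> linear T \<and>
    (\<forall>K. compact K \<longrightarrow> (\<exists>C N. \<forall>\<phi>. support (Rep_test_fun \<phi>) \<subseteq> K \<longrightarrow>
       \<bar>T \<phi>\<bar> \<le> C * (\<Sum>w | length w \<le> N. SUP x. \<bar>partial_derivs w (Rep_test_fun \<phi>) x\<bar>)))"

definition dirac :: "'m::finite test_fun \<Rightarrow> real"
  where "dirac \<phi> = Rep_test_fun \<phi> 0"

text \<open>The operations on distributions are defined for functionals with values in any
  real vector space, so that they also act on the first factor of a tensor product.\<close>

definition dist_deriv :: "'m::finite \<Rightarrow> ('m test_fun \<Rightarrow> 'w::real_vector) \<Rightarrow> 'm test_fun \<Rightarrow> 'w"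
  where "dist_deriv i F = (\<lambda>\<phi>. - F (test_deriv i \<phi>))"

definition dist_mult :: "'m::finite smooth_fun \<Rightarrow> ('m test_fun \<Rightarrow> 'w::real_vector) \<Rightarrow> 'm test_fun \<Rightarrow> 'w"
  where "dist_mult a F = (\<lambda>\<phi>. F (test_mult a \<phi>))"

text \<open>The operator of order at most \<open>d\<close> with smooth coefficients \<open>a w\<close>, i.e. the sum over
  \<open>r \<le> d\<close> and \<open>i1, \<dots>, ir\<close> of \<open>a [i1, \<dots>, ir]\<close> times the iterated derivative.\<close>

definition pdo :: "nat \<Rightarrow> ('m list \<Rightarrow> 'm smooth_fun) \<Rightarrow>
    ('m::finite test_fun \<Rightarrow> 'w::real_vector) \<Rightarrow> 'm test_fun \<Rightarrow> 'w"
  where "pdo d a F = (\<lambda>\<phi>. \<Sum>w | length w \<le> d. dist_mult (a w) (foldr dist_deriv w F) \<phi>)"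

definition principal_symbol :: "nat \<Rightarrow> ('m list \<Rightarrow> 'm::finite smooth_fun) \<Rightarrow> real ^ 'm \<Rightarrow> real ^ 'm \<Rightarrow> real"
  where "principal_symbol d a x \<xi> = (\<Sum>w | length w = d. Rep_smooth_fun (a w) x * (\<Prod>i\<leftarrow>w. \<xi> $ i))"

definition elliptic :: "nat \<Rightarrow> ('m list \<Rightarrow> 'm::finite smooth_fun) \<Rightarrow> bool"
  where "elliptic d a \<longleftrightarrow> (\<forall>x \<xi>. \<xi> \<noteq> 0 \<longrightarrow> principal_symbol d a x \<xi> \<noteq> 0)"

definition fundamental_solution ::
    "(('m::finite test_fun \<Rightarrow> real) \<Rightarrow> 'm test_fun \<Rightarrow> real) \<Rightarrow> ('m test_fun \<Rightarrow> real) \<Rightarrow> bool"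
  where "fundamental_solution Q T \<longleftrightarrow> distribution T \<and> Q T = dirac"


section \<open>Algebras given by generators and relations\<close>

text \<open>The free real algebra on an alphabet consists of the finitely supported real functions
  on words; its product is the convolution induced by concatenation.\<close>

datatype 'g free_word = Free_Word (letters: "'g list")

instantiation free_word :: (type) monoid_add
begin

definition zero_free_word :: "'a free_word" where "0 = Free_Word []"

definition plus_free_word :: "'a free_word \<Rightarrow> 'a free_word \<Rightarrow> 'a free_word"
  where "v + w = Free_Word (letters v @ letters w)"

instance
  by standard (auto simp: zero_free_word_def plus_free_word_def)

end

type_synonym 'g free_algebra = "'g free_word \<Rightarrow>\<^sub>0 real"

definition free_gen :: "'g \<Rightarrow> 'g free_algebra"
  where "free_gen g = Poly_Mapping.single (Free_Word [g]) 1"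

definition free_on :: "'g set \<Rightarrow> 'g free_algebra set"
  where "free_on X = {p. \<forall>w \<in> Poly_Mapping.keys p. set (letters w) \<subseteq> X}"

definition free_eval :: "('g \<Rightarrow> 'c::real_algebra_1) \<Rightarrow> 'g free_algebra \<Rightarrow> 'c"
  where "free_eval h p =
    (\<Sum>w \<in> Poly_Mapping.keys p. Poly_Mapping.lookup p w *\<^sub>R prod_list (map h (letters w)))"

inductive_set two_sided_ideal :: "'r::ring_1 set \<Rightarrow> 'r set \<Rightarrow> 'r set" for A R where
  zero: "0 \<in> two_sided_ideal A R"
| gen: "a \<in> A \<Longrightarrow> r \<in> R \<Longrightarrow> b \<in> A \<Longrightarrow> a * r * b \<in> two_sided_ideal A R"
| add: "p \<in> two_sided_ideal A R \<Longrightarrow> q \<in> two_sided_ideal A R \<Longrightarrow> p + q \<in> two_sided_ideal A R"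

text \<open>The real algebra \<open>'c\<close> is generated by the elements \<open>h g\<close> (\<open>g \<in> X\<close>), with defining relators
  \<open>R\<close>: evaluation identifies it with the free algebra on \<open>X\<close> modulo the ideal generated
  by \<open>R\<close>.\<close>

definition presented_by :: "('g \<Rightarrow> 'c::real_algebra_1) \<Rightarrow> 'g set \<Rightarrow> 'g free_algebra set \<Rightarrow> bool"
  where "presented_by h X R \<longleftrightarrow>
    free_eval h ` free_on X = UNIV \<and>
    {p \<in> free_on X. free_eval h p = 0} = two_sided_ideal (free_on X) R"

datatype 'm cw_gen = Orth 'm | Symp nat

definition cw_generators :: "nat \<Rightarrow> 'm cw_gen set"
  where "cw_generators n = range Orth \<union> Symp ` {1..2 * n}"

definition cw_relators :: "nat \<Rightarrow> 'm cw_gen free_algebra set"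
  where "cw_relators n =
    {free_gen (Orth j) * free_gen (Orth k) + free_gen (Orth k) * free_gen (Orth j)
       + 2 * of_bool (j = k) | j k. True} \<union>
    {free_gen (Symp (2 * j)) * free_gen (Symp (2 * k))
       - free_gen (Symp (2 * k)) * free_gen (Symp (2 * j)) | j k. j \<in> {1..n} \<and> k \<in> {1..n}} \<union>
    {free_gen (Symp (2 * j - 1)) * free_gen (Symp (2 * k - 1))
       - free_gen (Symp (2 * k - 1)) * free_gen (Symp (2 * j - 1)) | j k. j \<in> {1..n} \<and> k \<in> {1..n}} \<union>
    {free_gen (Symp (2 * j - 1)) * free_gen (Symp (2 * k))
       - free_gen (Symp (2 * k)) * free_gen (Symp (2 * j - 1)) - of_bool (j = k) | j k.
       j \<in> {1..n} \<and> k \<in> {1..n}} \<union>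
    {free_gen (Orth j) * free_gen (Symp k) + free_gen (Symp k) * free_gen (Orth j) | j k.
       k \<in> {1..2 * n}}"

definition clifford_weyl :: "nat \<Rightarrow> ('m \<Rightarrow> 'c::real_algebra_1) \<Rightarrow> (nat \<Rightarrow> 'c) \<Rightarrow> bool"
  where "clifford_weyl n e eg \<longleftrightarrow>
    presented_by (case_cw_gen e eg) (cw_generators n) (cw_relators n)"


section \<open>The Grassmann algebra with coefficients in an algebra\<close>

text \<open>An element is given by its coefficients with respect to the basis of the products
  \<open>x\<^sub>A = x\<^sub>j\<^sub>1 \<cdots> x\<^sub>j\<^sub>r\<close>, where \<open>A = {j1 < \<dots> < jr}\<close> is a finite set of
  naturals; the coefficients commute with the variables. The Grassmann algebra in
  \<open>x\<^sub>1, \<dots>, x\<^sub>N\<close> consists of the elements supported on subsets of \<open>{1..N}\<close>.\<close>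

typedef (overloaded) 'c grassmann =
  "{f :: nat set \<Rightarrow> 'c::zero. finite {A. f A \<noteq> 0} \<and> (\<forall>A. f A \<noteq> 0 \<longrightarrow> finite A)}"
  morphisms gcoeff Abs_grassmann
  by (rule exI[of _ "\<lambda>A. 0"]) simp

setup_lifting type_definition_grassmann

text \<open>For disjoint \<open>A\<close> and \<open>B\<close> one has \<open>x\<^sub>A x\<^sub>B = \<plusminus> x\<^bsub>A \<union> B\<^esub>\<close> with the following sign.\<close>

definition shuffle_sign :: "nat set \<Rightarrow> nat set \<Rightarrow> real"
  where "shuffle_sign A B = (- 1) ^ card {(a, b). a \<in> A \<and> b \<in> B \<and> b < a}"

lemma shuffle_sign_empty [simp]: "shuffle_sign {} B = 1" "shuffle_sign A {} = 1"
  by (auto simp: shuffle_sign_def)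

lemma shuffle_sign_square [simp]: "shuffle_sign A B * shuffle_sign A B = 1"
  by (simp add: shuffle_sign_def flip: power_mult_distrib)

lemma shuffle_sign_Un_left:
  assumes "finite A" "finite B" "finite C" "A \<inter> B = {}"
  shows "shuffle_sign (A \<union> B) C = shuffle_sign A C * shuffle_sign B C"
proof -
  have "{(a, c). a \<in> A \<union> B \<and> c \<in> C \<and> c < a}
      = {(a, c). a \<in> A \<and> c \<in> C \<and> c < a} \<union> {(a, c). a \<in> B \<and> c \<in> C \<and> c < a}" by auto
  moreover have "finite {(a, c). a \<in> A \<and> c \<in> C \<and> c < a}"
    by (rule finite_subset[of _ "A \<times> C"]) (use assms in auto)
  moreover have "finite {(a, c). a \<in> B \<and> c \<in> C \<and> c < a}"
    by (rule finite_subset[of _ "B \<times> C"]) (use assms in auto)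
  moreover have "{(a, c). a \<in> A \<and> c \<in> C \<and> c < a} \<inter> {(a, c). a \<in> B \<and> c \<in> C \<and> c < a} = {}"
    using assms(4) by auto
  ultimately show ?thesis
    by (simp add: shuffle_sign_def card_Un_disjoint power_add)
qed

lemma shuffle_sign_Un_right:
  assumes "finite A" "finite B" "finite C" "B \<inter> C = {}"
  shows "shuffle_sign A (B \<union> C) = shuffle_sign A B * shuffle_sign A C"
proof -
  have "{(a, c). a \<in> A \<and> c \<in> B \<union> C \<and> c < a}
      = {(a, c). a \<in> A \<and> c \<in> B \<and> c < a} \<union> {(a, c). a \<in> A \<and> c \<in> C \<and> c < a}" by auto
  moreover have "finite {(a, c). a \<in> A \<and> c \<in> B \<and> c < a}"
    by (rule finite_subset[of _ "A \<times> B"]) (use assms in auto)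
  moreover have "finite {(a, c). a \<in> A \<and> c \<in> C \<and> c < a}"
    by (rule finite_subset[of _ "A \<times> C"]) (use assms in auto)
  moreover have "{(a, c). a \<in> A \<and> c \<in> B \<and> c < a} \<inter> {(a, c). a \<in> A \<and> c \<in> C \<and> c < a} = {}"
    using assms(4) by auto
  ultimately show ?thesis
    by (simp add: shuffle_sign_def card_Un_disjoint power_add)
qed

lemma shuffle_sign_singletons: "shuffle_sign {j} {k} = (if k < j then - 1 else 1)"
proof -
  have "{(a, b). a \<in> {j} \<and> b \<in> {k} \<and> b < a} = (if k < j then {(j, k)} else {})" by auto
  then show ?thesis by (simp add: shuffle_sign_def)
qed

lemma shuffle_sign_swap:
  "j \<noteq> k \<Longrightarrow> shuffle_sign {j} {k} * shuffle_sign {k} {j} = - 1"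
  by (simp add: shuffle_sign_singletons)

lemma grassmann_eqI: "(\<And>A. finite A \<Longrightarrow> gcoeff f A = gcoeff g A) \<Longrightarrow> f = g"
  by transfer (metis ext)

instantiation grassmann :: (real_algebra_1) real_algebra_1
begin

lift_definition zero_grassmann :: "'a grassmann" is "\<lambda>A. 0" by simp

lift_definition one_grassmann :: "'a grassmann" is "\<lambda>A. if A = {} then 1 else 0" by simp

lift_definition plus_grassmann :: "'a grassmann \<Rightarrow> 'a grassmann \<Rightarrow> 'a grassmann"
  is "\<lambda>f g A. f A + g A"
proof -
  fix f g :: "nat set \<Rightarrow> 'a"
  assume f: "finite {A. f A \<noteq> 0} \<and> (\<forall>A. f A \<noteq> 0 \<longrightarrow> finite A)"
    and g: "finite {A. g A \<noteq> 0} \<and> (\<forall>A. g A \<noteq> 0 \<longrightarrow> finite A)"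
  have "{A. f A + g A \<noteq> 0} \<subseteq> {A. f A \<noteq> 0} \<union> {A. g A \<noteq> 0}" by auto
  then have "finite {A. f A + g A \<noteq> 0}"
    by (rule finite_subset) (use f g in auto)
  moreover have "finite A" if "f A + g A \<noteq> 0" for A
    using that f g by (cases "f A = 0") auto
  ultimately show "finite {A. f A + g A \<noteq> 0} \<and> (\<forall>A. f A + g A \<noteq> 0 \<longrightarrow> finite A)" by blast
qed

lift_definition uminus_grassmann :: "'a grassmann \<Rightarrow> 'a grassmann" is "\<lambda>f A. - f A" by simp

definition minus_grassmann :: "'a grassmann \<Rightarrow> 'a grassmann \<Rightarrow> 'a grassmann"
  where "f - g = f + - (g :: 'a grassmann)"

lift_definition scaleR_grassmann :: "real \<Rightarrow> 'a grassmann \<Rightarrow> 'a grassmann" is "\<lambda>c f A. c *\<^sub>R f A"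
proof -
  fix c and f :: "nat set \<Rightarrow> 'a"
  assume f: "finite {A. f A \<noteq> 0} \<and> (\<forall>A. f A \<noteq> 0 \<longrightarrow> finite A)"
  have "finite {A. c *\<^sub>R f A \<noteq> 0}"
    by (rule finite_subset[of _ "{A. f A \<noteq> 0}"]) (use f in auto)
  with f show "finite {A. c *\<^sub>R f A \<noteq> 0} \<and> (\<forall>A. c *\<^sub>R f A \<noteq> 0 \<longrightarrow> finite A)" by simp
qed

text \<open>The sum below is over the ways of writing \<open>A\<close> as a disjoint union; it vanishes for
  infinite \<open>A\<close>.\<close>

lift_definition times_grassmann :: "'a grassmann \<Rightarrow> 'a grassmann \<Rightarrow> 'a grassmann"
  is "\<lambda>f g A. \<Sum>B \<in> Pow A. shuffle_sign B (A - B) *\<^sub>R (f B * g (A - B))"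
proof -
  fix f g :: "nat set \<Rightarrow> 'a"
  let ?h = "\<lambda>A. \<Sum>B \<in> Pow A. shuffle_sign B (A - B) *\<^sub>R (f B * g (A - B))"
  assume f: "finite {A. f A \<noteq> 0} \<and> (\<forall>A. f A \<noteq> 0 \<longrightarrow> finite A)"
    and g: "finite {A. g A \<noteq> 0} \<and> (\<forall>A. g A \<noteq> 0 \<longrightarrow> finite A)"
  have fin: "finite A" if "?h A \<noteq> 0" for A
    using that sum.infinite[of "Pow A"] by (cases "finite A") auto
  have "{A. ?h A \<noteq> 0} \<subseteq> (\<lambda>(B, C). B \<union> C) ` ({A. f A \<noteq> 0} \<times> {A. g A \<noteq> 0})"
  proof
    fix A assume "A \<in> {A. ?h A \<noteq> 0}"
    then have "\<exists>B \<in> Pow A. shuffle_sign B (A - B) *\<^sub>R (f B * g (A - B)) \<noteq> 0"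
      using sum.neutral[of "Pow A" "\<lambda>B. shuffle_sign B (A - B) *\<^sub>R (f B * g (A - B))"] by auto
    then obtain B where "B \<subseteq> A" "f B \<noteq> 0" "g (A - B) \<noteq> 0"
      by (auto dest: mult_not_zero)
    then show "A \<in> (\<lambda>(B, C). B \<union> C) ` ({A. f A \<noteq> 0} \<times> {A. g A \<noteq> 0})"
      by (intro image_eqI[of _ _ "(B, A - B)"]) auto
  qed
  then have "finite {A. ?h A \<noteq> 0}"
    by (rule finite_subset) (use f g in auto)
  with fin show "finite {A. ?h A \<noteq> 0} \<and> (\<forall>A. ?h A \<noteq> 0 \<longrightarrow> finite A)" by blast
qed

instance
proof
  fix f g h :: "'a grassmann" and c d :: real
  show "f + g + h = f + (g + h)" "f + g = g + f" "0 + f = f" "- f + f = 0"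
    by (transfer; simp add: fun_eq_iff ac_simps)+
  show "f - g = f + - g" by (simp add: minus_grassmann_def)
  show "c *\<^sub>R (f + g) = c *\<^sub>R f + c *\<^sub>R g" "(c + d) *\<^sub>R f = c *\<^sub>R f + d *\<^sub>R f"
    "c *\<^sub>R d *\<^sub>R f = (c * d) *\<^sub>R f" "1 *\<^sub>R f = f"
    by (transfer; simp add: fun_eq_iff algebra_simps)+
  show "(f + g) * h = f * h + g * h" "f * (g + h) = f * g + f * h"
    by (transfer; simp add: fun_eq_iff algebra_simps sum.distrib)+
  show "c *\<^sub>R f * g = c *\<^sub>R (f * g)" "f * c *\<^sub>R g = c *\<^sub>R (f * g)"
    by (transfer; simp add: fun_eq_iff scaleR_sum_right ac_simps)+
  show "(0 :: 'a grassmann) \<noteq> 1"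
    by transfer (metis zero_neq_one)
  show "1 * f = f"
  proof (rule grassmann_eqI)
    fix A :: "nat set" assume "finite A"
    then have "gcoeff (1 * f) A
        = (\<Sum>B \<in> Pow A. if B = {} then gcoeff f A else 0)"
      unfolding times_grassmann.rep_eq one_grassmann.rep_eq by (intro sum.cong) auto
    then show "gcoeff (1 * f) A = gcoeff f A" using \<open>finite A\<close> by simp
  qed
  show "f * 1 = f"
  proof (rule grassmann_eqI)
    fix A :: "nat set" assume "finite A"
    then have "gcoeff (f * 1) A
        = (\<Sum>B \<in> Pow A. if B = A then gcoeff f A else 0)"
      unfolding times_grassmann.rep_eq one_grassmann.rep_eq by (intro sum.cong) auto
    then show "gcoeff (f * 1) A = gcoeff f A" using \<open>finite A\<close> by simp
  qed
  show "f * g * h = f * (g * h)"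
  proof (rule grassmann_eqI)
    fix A :: "nat set" assume A: "finite A"
    define t where "t B C E = (shuffle_sign B C * shuffle_sign B E * shuffle_sign C E)
        *\<^sub>R (gcoeff f B * gcoeff g C * gcoeff h E)" for B C E
    have "gcoeff (f * g * h) A = (\<Sum>D \<in> Pow A. \<Sum>B \<in> Pow D. t B (D - B) (A - D))"
      unfolding times_grassmann.rep_eq
    proof (rule sum.cong[OF refl])
      fix D assume D: "D \<in> Pow A"
      have "shuffle_sign D (A - D) = shuffle_sign B (A - D) * shuffle_sign (D - B) (A - D)"
        if "B \<in> Pow D" for B
      proof -
        have "B \<union> (D - B) = D" using that by auto
        moreover have "finite B" "finite (D - B)" "finite (A - D)"
          using A D that finite_subset[of D A] finite_subset[of B A] by auto
        ultimately show ?thesis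
          using shuffle_sign_Un_left[of B "D - B" "A - D"] by auto
      qed
      then show "shuffle_sign D (A - D) *\<^sub>R
          ((\<Sum>B \<in> Pow D. shuffle_sign B (D - B) *\<^sub>R (gcoeff f B * gcoeff g (D - B))) * gcoeff h (A - D))
          = (\<Sum>B \<in> Pow D. t B (D - B) (A - D))"
        by (auto simp: t_def sum_distrib_right scaleR_sum_right mult.assoc intro!: sum.cong)
    qed
    also have "\<dots> = (\<Sum>(D, B) \<in> (SIGMA D:Pow A. Pow D). t B (D - B) (A - D))"
      using A by (intro sum.Sigma) (auto intro: finite_subset[of _ A])
    also have "\<dots> = (\<Sum>(B, C) \<in> (SIGMA B:Pow A. Pow (A - B)). t B C (A - B - C))"
    proof (rule sum.reindex_bij_witness[of _ "\<lambda>(B, C). (B \<union> C, B)" "\<lambda>(D, B). (B, D - B)"])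
      fix p assume "p \<in> (SIGMA D:Pow A. Pow D)"
      then obtain D B where p: "p = (D, B)" "D \<subseteq> A" "B \<subseteq> D" by blast
      then have "A - B - (D - B) = A - D" "B \<union> (D - B) = D" "D - B \<subseteq> A - B" "B \<subseteq> A" by auto
      with p show "(case case p of (D, B) \<Rightarrow> (B, D - B) of (B, C) \<Rightarrow> (B \<union> C, B)) = p"
        "(case p of (D, B) \<Rightarrow> (B, D - B)) \<in> (SIGMA B:Pow A. Pow (A - B))"
        "(case case p of (D, B) \<Rightarrow> (B, D - B) of (B, C) \<Rightarrow> t B C (A - B - C))
           = (case p of (D, B) \<Rightarrow> t B (D - B) (A - D))"
        by simp_all
    next
      fix p assume "p \<in> (SIGMA B:Pow A. Pow (A - B))"
      then obtain B C where p: "p = (B, C)" "B \<subseteq> A" "C \<subseteq> A - B" by blast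
      then have "B \<union> C - B = C" "B \<union> C \<subseteq> A" by auto
      with p show "(case case p of (B, C) \<Rightarrow> (B \<union> C, B) of (D, B) \<Rightarrow> (B, D - B)) = p"
        "(case p of (B, C) \<Rightarrow> (B \<union> C, B)) \<in> (SIGMA D:Pow A. Pow D)"
        by simp_all
    qed
    also have "\<dots> = (\<Sum>B \<in> Pow A. \<Sum>C \<in> Pow (A - B). t B C (A - B - C))"
      using A by (intro sum.Sigma[symmetric]) auto
    also have "\<dots> = gcoeff (f * (g * h)) A"
      unfolding times_grassmann.rep_eq
    proof (rule sum.cong[OF refl])
      fix B assume B: "B \<in> Pow A"
      have "shuffle_sign B (A - B) = shuffle_sign B C * shuffle_sign B (A - B - C)"
        if "C \<in> Pow (A - B)" for C
      proof -
        have "C \<union> (A - B - C) = A - B" using that by auto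
        moreover have "finite B" "finite C" "finite (A - B - C)"
          using A B that finite_subset[of B A] finite_subset[of C A] by auto
        ultimately show ?thesis
          using shuffle_sign_Un_right[of B C "A - B - C"] by auto
      qed
      then show "(\<Sum>C \<in> Pow (A - B). t B C (A - B - C)) = shuffle_sign B (A - B) *\<^sub>R (gcoeff f B *
          (\<Sum>C \<in> Pow (A - B). shuffle_sign C (A - B - C) *\<^sub>R (gcoeff g C * gcoeff h (A - B - C))))"
        by (auto simp: t_def sum_distrib_left scaleR_sum_right mult.assoc intro!: sum.cong)
    qed
    finally show "gcoeff (f * g * h) A = gcoeff (f * (g * h)) A" .
  qed
qed

end

lift_definition grassmann_var :: "nat \<Rightarrow> 'c::real_algebra_1 grassmann"
  is "\<lambda>j A. if A = {j} then 1 else 0" by simp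

lift_definition grassmann_const :: "'c::real_algebra_1 \<Rightarrow> 'c grassmann"
  is "\<lambda>c A. if A = {} then c else 0" by simp

text \<open>The left derivative sends \<open>x\<^sub>j x\<^sub>A\<close> to \<open>x\<^sub>A\<close> for \<open>j \<notin> A\<close>, and \<open>x\<^sub>A\<close> to zero; the lemmas
  below show that it satisfies the usual recursive characterization.\<close>

lift_definition grassmann_deriv :: "nat \<Rightarrow> 'c::real_algebra_1 grassmann \<Rightarrow> 'c grassmann"
  is "\<lambda>j f A. if j \<in> A then 0 else shuffle_sign {j} A *\<^sub>R f (insert j A)"
proof -
  fix j and f :: "nat set \<Rightarrow> 'c"
  let ?h = "\<lambda>A. if j \<in> A then 0 else shuffle_sign {j} A *\<^sub>R f (insert j A)"
  assume f: "finite {A. f A \<noteq> 0} \<and> (\<forall>A. f A \<noteq> 0 \<longrightarrow> finite A)"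
  then have f1: "finite {A. f A \<noteq> 0}" and f2: "f A \<noteq> 0 \<Longrightarrow> finite A" for A
    by auto
  have nz: "j \<notin> A \<and> f (insert j A) \<noteq> 0" if "?h A \<noteq> 0" for A
    using that by (cases "j \<in> A") auto
  show "finite {A. ?h A \<noteq> 0} \<and> (\<forall>A. ?h A \<noteq> 0 \<longrightarrow> finite A)"
  proof (intro conjI allI impI)
    show "finite {A. ?h A \<noteq> 0}"
    proof (rule finite_subset[OF _ finite_imageI[OF f1, of "\<lambda>A. A - {j}"]], rule subsetI)
      fix A assume "A \<in> {A. ?h A \<noteq> 0}"
      then have A: "j \<notin> A" "f (insert j A) \<noteq> 0" using nz[of A] by (auto simp only: mem_Collect_eq)
      then show "A \<in> (\<lambda>A. A - {j}) ` {A. f A \<noteq> 0}"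
        by (intro image_eqI[where x = "insert j A"]) simp_all
    qed
    show "finite A" if "?h A \<noteq> 0" for A
      using f2[of "insert j A"] nz[OF that] by simp
  qed
qed

lemma gcoeff_var_mult:
  assumes "finite A"
  shows "gcoeff (grassmann_var k * F) A =
    (if k \<in> A then shuffle_sign {k} (A - {k}) *\<^sub>R gcoeff F (A - {k}) else 0)"
proof -
  have "gcoeff (grassmann_var k * F) A = (\<Sum>B \<in> Pow A. if B = {k} then
      shuffle_sign {k} (A - {k}) *\<^sub>R gcoeff F (A - {k}) else 0)"
    unfolding times_grassmann.rep_eq grassmann_var.rep_eq by (intro sum.cong) auto
  with assms show ?thesis by simp
qed

lemma grassmann_deriv_var_mult:
  "grassmann_deriv j (grassmann_var k * F) =
     (if j = k then F else 0) - grassmann_var k * grassmann_deriv j F"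
proof (rule grassmann_eqI)
  fix A :: "nat set" assume A: "finite A"
  have minus: "gcoeff (F - G) A = gcoeff F A - gcoeff G A" for F G :: "'a grassmann"
    unfolding minus_grassmann_def plus_grassmann.rep_eq uminus_grassmann.rep_eq by simp
  have zero: "gcoeff (0 :: 'a grassmann) A = 0" by (simp add: zero_grassmann.rep_eq)
  show "gcoeff (grassmann_deriv j (grassmann_var k * F)) A =
     gcoeff ((if j = k then F else 0) - grassmann_var k * grassmann_deriv j F) A"
  proof (cases "j = k")
    case True
    then show ?thesis
      using A by (cases "k \<in> A")
        (auto simp: minus zero gcoeff_var_mult uminus_grassmann.rep_eq grassmann_deriv.rep_eq insert_absorb)
  next
    case False
    show ?thesis
    proof (cases "j \<notin> A \<and> k \<in> A")
      case True
      then obtain B where AB: "A = insert k B" and kB: "k \<notin> B"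
        by (meson Set.set_insert)
      have jB: "j \<notin> B" "k \<noteq> j" and fB: "finite B"
        using True A False AB by auto
      have s1: "shuffle_sign {j} A = shuffle_sign {j} {k} * shuffle_sign {j} B"
        using shuffle_sign_Un_right[of "{j}" "{k}" B] fB kB AB by simp
      have s2: "shuffle_sign {k} (insert j B) = shuffle_sign {k} {j} * shuffle_sign {k} B"
        using shuffle_sign_Un_right[of "{k}" "{j}" B] fB jB by simp
      have "shuffle_sign {j} A * shuffle_sign {k} (insert j B)
          = (shuffle_sign {j} {k} * shuffle_sign {k} {j}) * (shuffle_sign {k} B * shuffle_sign {j} B)"
        unfolding s1 s2 by (simp only: ac_simps)
      also have "\<dots> = - (shuffle_sign {k} B * shuffle_sign {j} B)"
        using shuffle_sign_swap[OF False] by simp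
      finally have sign: "shuffle_sign {j} A * shuffle_sign {k} (insert j B)
          = - (shuffle_sign {k} B * shuffle_sign {j} B)" .
      have "insert j A - {k} = insert j B" "A - {k} = B"
        using AB kB jB by auto
      then have "gcoeff (grassmann_deriv j (grassmann_var k * F)) A
          = (shuffle_sign {j} A * shuffle_sign {k} (insert j B)) *\<^sub>R gcoeff F (insert j B)"
        and "gcoeff (grassmann_var k * grassmann_deriv j F) A
          = (shuffle_sign {k} B * shuffle_sign {j} B) *\<^sub>R gcoeff F (insert j B)"
        using A True jB by (simp_all add: gcoeff_var_mult grassmann_deriv.rep_eq)
      then show ?thesis
        using False by (simp add: uminus_grassmann.rep_eq sign)
    next
      case False
      then show ?thesis
        using A \<open>j \<noteq> k\<close>
        by (auto simp: gcoeff_var_mult uminus_grassmann.rep_eq grassmann_deriv.rep_eq)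
    qed
  qed
qed

lemma grassmann_deriv_const: "grassmann_deriv j (grassmann_const c) = 0"
  by (rule grassmann_eqI)
     (simp add: grassmann_deriv.rep_eq grassmann_const.rep_eq zero_grassmann.rep_eq)

lemma grassmann_deriv_add: "grassmann_deriv j (F + G) = grassmann_deriv j F + grassmann_deriv j G"
  by (rule grassmann_eqI)
     (simp add: grassmann_deriv.rep_eq plus_grassmann.rep_eq scaleR_add_right)

lemma grassmann_var_anticommute:
  "grassmann_var j * grassmann_var k = - (grassmann_var k * grassmann_var j :: 'c::real_algebra_1 grassmann)"
proof (rule grassmann_eqI)
  fix A :: "nat set" assume A: "finite A"
  show "gcoeff (grassmann_var j * grassmann_var k) A
      = gcoeff (- (grassmann_var k * grassmann_var j :: 'c grassmann)) A"
  proof (cases "j \<noteq> k \<and> A = {j, k}")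
    case True
    then have "{j, k} - {j} = {k}" "{j, k} - {k} = {j}" by auto
    moreover have "shuffle_sign {j} {k} = - shuffle_sign {k} {j}"
      using True by (auto simp: shuffle_sign_singletons)
    ultimately show ?thesis
      using True by (simp add: gcoeff_var_mult uminus_grassmann.rep_eq grassmann_var.rep_eq)
  next
    case False
    then show ?thesis
      using A by (auto simp: gcoeff_var_mult uminus_grassmann.rep_eq grassmann_var.rep_eq)
  qed
qed


section \<open>Super distributions\<close>

text \<open>The algebraic tensor product of the space of distributions with a vector space \<open>'w\<close> is
  identified with the space of \<open>'w\<close>-valued functionals that are finite sums of the following
  ones.\<close>

definition tensor :: "('m::finite test_fun \<Rightarrow> real) \<Rightarrow> 'w::real_vector \<Rightarrow> 'm test_fun \<Rightarrow> 'w"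
    (infixr \<open>\<otimes>\<^sub>D\<close> 75)
  where "T \<otimes>\<^sub>D w = (\<lambda>\<phi>. T \<phi> *\<^sub>R w)"

definition grassmann_on :: "nat \<Rightarrow> 'c::real_algebra_1 grassmann set"
  where "grassmann_on N = {F. \<forall>A. gcoeff F A \<noteq> 0 \<longrightarrow> A \<subseteq> {1..N}}"

definition super_distribution :: "nat \<Rightarrow> ('m::finite test_fun \<Rightarrow> 'c::real_algebra_1 grassmann) \<Rightarrow> bool"
  where "super_distribution n F \<longleftrightarrow>
    (\<exists>(r::nat) T w. (\<forall>i<r. distribution (T i) \<and> w i \<in> grassmann_on (2 * n)) \<and>
       F = (\<lambda>\<phi>. \<Sum>i<r. (T i \<otimes>\<^sub>D w i) \<phi>))"

definition super_dirac :: "nat \<Rightarrow> 'm::finite test_fun \<Rightarrow> 'c::real_algebra_1 grassmann"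
  where "super_dirac n = dirac \<otimes>\<^sub>D prod_list (map grassmann_var [1..<2 * n + 1])"

definition fermionic_vector :: "nat \<Rightarrow> (nat \<Rightarrow> 'c::real_algebra_1) \<Rightarrow> 'c grassmann"
  where "fermionic_vector n eg = (\<Sum>j = 1..2 * n. grassmann_var j * grassmann_const (eg j))"

definition fermionic_laplace :: "nat \<Rightarrow> ('m test_fun \<Rightarrow> 'c::real_algebra_1 grassmann) \<Rightarrow>
    'm::finite test_fun \<Rightarrow> 'c grassmann"
  where "fermionic_laplace n F =
    (\<lambda>\<phi>. 4 *\<^sub>R (\<Sum>j = 1..n. grassmann_deriv (2 * j - 1) (grassmann_deriv (2 * j) (F \<phi>))))"

definition super_pdo :: "nat \<Rightarrow> nat \<Rightarrow> ('m list \<Rightarrow> 'm smooth_fun) \<Rightarrow>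
    ('m test_fun \<Rightarrow> 'c::real_algebra_1 grassmann) \<Rightarrow> 'm::finite test_fun \<Rightarrow> 'c grassmann"
  where "super_pdo n d a F = (\<lambda>\<phi>. pdo d a F \<phi> + fermionic_laplace n F \<phi>)"

definition super_fundamental_solution :: "nat \<Rightarrow>
    (('m::finite test_fun \<Rightarrow> 'c grassmann) \<Rightarrow> 'm test_fun \<Rightarrow> 'c grassmann) \<Rightarrow>
    ('m test_fun \<Rightarrow> 'c::real_algebra_1 grassmann) \<Rightarrow> bool"
  where "super_fundamental_solution n Q F \<longleftrightarrow> super_distribution n F \<and> Q F = super_dirac n"

end

(*
  Put \<theta> = x1 x2 + ... + x_{2n-1} x_{2n}, the square of the fermionic vector variable. Commuting
  \<Delta>_f past multiplication by \<theta> produces 4 times the Euler operator minus 4 n, whence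
  \<Delta>_f \<theta>^s = - 4 s (n - s + 1) \<theta>^(s-1). Comparing coefficients then shows that P maps the
  candidate for k + 1 to the candidate for k, and the candidate for k = 0, where mu_0 is read as the
  Dirac distribution, is delta(x) because \<theta>^n = n! x1 ... x_{2n}.
*)
theory Submission
  imports Defs
begin

subsection \<open>Consequences of the Clifford-Weyl relations\<close>

text \<open>\<open>free_eval\<close> sums over the support, which shrinks under cancellation. A
  common finite superset makes the sums for \<open>p\<close>, \<open>q\<close> and
  \<open>p - q\<close> comparable term by term.\<close>

lemma free_eval_superset:
  assumes "finite S" "Poly_Mapping.keys p \<subseteq> S"
  shows "free_eval h p = (\<Sum>w\<in>S. Poly_Mapping.lookup p w *\<^sub>R prod_list (map h (letters w)))"
  unfolding free_eval_def
  using assms by (intro sum.mono_neutral_left) (auto simp: in_keys_iff)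

lemma free_eval_diff: "free_eval h (p - q) = free_eval h p - free_eval h q"
proof -
  let ?S = "Poly_Mapping.keys p \<union> Poly_Mapping.keys q"
  have "Poly_Mapping.keys (p - q) \<subseteq> ?S"
    by (rule keys_diff)
  then show ?thesis
    by (simp add: free_eval_superset[of ?S] lookup_minus scaleR_diff_left sum_subtractf)
qed

lemma free_eval_single:
  "free_eval h (Poly_Mapping.single w c) = c *\<^sub>R prod_list (map h (letters w))"
  by (simp add: free_eval_superset[of "{w}"])

text \<open>The relators that enter are quadratic in the generators, so evaluation is computed on
  products of two of them.\<close>

lemma free_eval_gen_mult_gen: "free_eval h (free_gen a * free_gen b) = h a * h b"
  by (simp add: free_gen_def mult_single free_eval_single plus_free_word_def)

lemma free_eval_one: "free_eval h 1 = 1"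
  by (simp add: single_one[symmetric] free_eval_single zero_free_word_def del: single_one)

lemma free_eval_of_bool: "free_eval h (of_bool P) = of_bool P"
  by (simp add: of_bool_def free_eval_one) (simp add: free_eval_def)

lemma one_in_free_on: "1 \<in> free_on X"
  by (simp add: free_on_def zero_free_word_def)

text \<open>The ideal contains \<open>1 * r * 1\<close> and coincides with the kernel of
  evaluation.\<close>

lemma presented_by_relator:
  assumes "presented_by h X R" "r \<in> R"
  shows "free_eval h r = 0"
proof -
  have "1 * r * 1 \<in> two_sided_ideal (free_on X) R"
    using one_in_free_on assms(2) by (rule two_sided_ideal.gen) (rule one_in_free_on)
  then have "1 * r * 1 \<in> {p \<in> free_on X. free_eval h p = 0}"
    using assms(1) by (simp only: presented_by_def)
  then show ?thesis by simp
qed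

lemma clifford_weyl_symp:
  assumes "clifford_weyl n e eg" "j \<in> {1..n}" "k \<in> {1..n}"
  shows clifford_weyl_even_even: "eg (2 * j) * eg (2 * k) = eg (2 * k) * eg (2 * j)"
    and clifford_weyl_odd_odd: "eg (2 * j - 1) * eg (2 * k - 1) = eg (2 * k - 1) * eg (2 * j - 1)"
    and clifford_weyl_odd_even:
      "eg (2 * j - 1) * eg (2 * k) - eg (2 * k) * eg (2 * j - 1) = of_bool (j = k)"
proof -
  note rel = presented_by_relator[OF assms(1)[unfolded clifford_weyl_def]]
  note ev = free_eval_diff free_eval_gen_mult_gen free_eval_of_bool
  have "free_eval (case_cw_gen e eg) (free_gen (Symp (2 * j)) * free_gen (Symp (2 * k))
       - free_gen (Symp (2 * k)) * free_gen (Symp (2 * j))) = 0"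
    by (rule rel) (use assms(2,3) in \<open>unfold cw_relators_def, blast\<close>)
  then show "eg (2 * j) * eg (2 * k) = eg (2 * k) * eg (2 * j)"
    by (simp add: ev)
  have "free_eval (case_cw_gen e eg) (free_gen (Symp (2 * j - 1)) * free_gen (Symp (2 * k - 1))
       - free_gen (Symp (2 * k - 1)) * free_gen (Symp (2 * j - 1))) = 0"
    by (rule rel) (use assms(2,3) in \<open>unfold cw_relators_def, blast\<close>)
  then show "eg (2 * j - 1) * eg (2 * k - 1) = eg (2 * k - 1) * eg (2 * j - 1)"
    by (simp add: ev)
  have "free_eval (case_cw_gen e eg) (free_gen (Symp (2 * j - 1)) * free_gen (Symp (2 * k))
       - free_gen (Symp (2 * k)) * free_gen (Symp (2 * j - 1)) - of_bool (j = k)) = 0"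
    by (rule rel) (use assms(2,3) in \<open>unfold cw_relators_def, blast\<close>)
  then show "eg (2 * j - 1) * eg (2 * k) - eg (2 * k) * eg (2 * j - 1) = of_bool (j = k)"
    by (simp add: ev)
qed

subsection \<open>The Grassmann algebra\<close>

lemma grassmann_const_mult: "grassmann_const c * grassmann_const d = grassmann_const (c * d)"
proof (rule grassmann_eqI)
  fix A :: "nat set" assume A: "finite A"
  have "gcoeff (grassmann_const c * grassmann_const d) A
      = (\<Sum>B \<in> Pow A. if B = {} then (if A = {} then c * d else 0) else 0)"
    unfolding times_grassmann.rep_eq grassmann_const.rep_eq by (intro sum.cong) auto
  then show "gcoeff (grassmann_const c * grassmann_const d) A = gcoeff (grassmann_const (c * d)) A"
    using A by (simp add: grassmann_const.rep_eq)
qed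

lemma gcoeff_diff: "gcoeff (F - G) A = gcoeff F A - gcoeff G A"
  unfolding minus_grassmann_def plus_grassmann.rep_eq uminus_grassmann.rep_eq by simp

lemma grassmann_const_diff: "grassmann_const (c - d) = grassmann_const c - grassmann_const d"
  by (rule grassmann_eqI) (simp add: gcoeff_diff grassmann_const.rep_eq)

lemma grassmann_const_1: "grassmann_const 1 = 1"
  by (rule grassmann_eqI) (simp add: one_grassmann.rep_eq grassmann_const.rep_eq)

lemma grassmann_const_mult_var: "grassmann_const c * grassmann_var j = grassmann_var j * grassmann_const c"
proof (rule grassmann_eqI)
  fix A :: "nat set" assume A: "finite A"
  have "gcoeff (grassmann_const c * grassmann_var j) A
      = (\<Sum>B \<in> Pow A. if B = {} then (if A = {j} then c else 0) else 0)"
    unfolding times_grassmann.rep_eq grassmann_const.rep_eq grassmann_var.rep_eq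
    by (intro sum.cong) auto
  then show "gcoeff (grassmann_const c * grassmann_var j) A = gcoeff (grassmann_var j * grassmann_const c) A"
    using A by (auto simp: gcoeff_var_mult grassmann_const.rep_eq)
qed

text \<open>Anticommuting a variable with itself gives twice its square equal to zero, and 2 is
  invertible over the reals.\<close>

lemma grassmann_var_square: "grassmann_var j * grassmann_var j = (0 :: 'c::real_algebra_1 grassmann)"
proof -
  have "2 *\<^sub>R (grassmann_var j * grassmann_var j) = (0 :: 'c grassmann)"
    using grassmann_var_anticommute[of j j, where 'c = 'c] by (simp add: scaleR_2 eq_neg_iff_add_eq_0)
  then show ?thesis by simp
qed

text \<open>Two sign changes cancel: a product of two variables is even and commutes with every
  variable.\<close>

lemma grassmann_var_mult_pair:
  "grassmann_var i * (grassmann_var j * grassmann_var k)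
     = grassmann_var j * grassmann_var k * (grassmann_var i :: 'c::real_algebra_1 grassmann)"
proof -
  have "grassmann_var i * (grassmann_var j * grassmann_var k)
      = - (grassmann_var j * grassmann_var i * (grassmann_var k :: 'c grassmann))"
    by (subst mult.assoc[symmetric], subst grassmann_var_anticommute) simp
  also have "\<dots> = grassmann_var j * - (grassmann_var i * grassmann_var k)"
    by (simp add: mult.assoc)
  also have "- (grassmann_var i * grassmann_var k) = grassmann_var k * (grassmann_var i :: 'c grassmann)"
    by (rule grassmann_var_anticommute[symmetric])
  finally show ?thesis by (simp add: mult.assoc)
qed

lemma grassmann_deriv_scaleR: "grassmann_deriv j (c *\<^sub>R F) = c *\<^sub>R grassmann_deriv j F"
  by (rule grassmann_eqI) (simp add: grassmann_deriv.rep_eq scaleR_grassmann.rep_eq)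

lemma linear_grassmann_deriv: "linear (grassmann_deriv j)"
  by (rule linearI) (simp_all add: grassmann_deriv_add grassmann_deriv_scaleR)

lemmas grassmann_deriv_linear_simps =
  linear_add[OF linear_grassmann_deriv] linear_sum[OF linear_grassmann_deriv]
  linear_diff[OF linear_grassmann_deriv] linear_neg[OF linear_grassmann_deriv]

lemma grassmann_deriv_1: "grassmann_deriv j 1 = 0"
  by (metis grassmann_deriv_const grassmann_const_1)

section \<open>The square of the fermionic vector variable\<close>

definition sym_square :: "nat \<Rightarrow> 'c::real_algebra_1 grassmann"
  where "sym_square n = (\<Sum>j = 1..n. grassmann_var (2 * j - 1) * grassmann_var (2 * j))"

lemma sym_square_Suc:
  "sym_square (Suc n) = sym_square n + grassmann_var (2 * n + 1) * grassmann_var (2 * n + 2)"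
  by (simp add: sym_square_def)

lemma fermionic_vector_Suc:
  "fermionic_vector (Suc n) eg = fermionic_vector n eg
     + (grassmann_var (2 * n + 1) * grassmann_const (eg (2 * n + 1))
        + grassmann_var (2 * n + 2) * grassmann_const (eg (2 * n + 2)))"
  by (simp add: fermionic_vector_def add.assoc)

text \<open>Collecting the constants on the right separates the factor governed by anticommutation
  from the factor governed by the Clifford-Weyl relations.\<close>

lemma var_const_mult:
  "grassmann_var j * grassmann_const c * (grassmann_var k * grassmann_const d)
     = grassmann_var j * grassmann_var k * grassmann_const (c * d)"
  by (metis grassmann_const_mult grassmann_const_mult_var mult.assoc)

text \<open>The algebra is fixed by \<open>n\<close>, so the induction runs over the number
  \<open>i\<close> of symplectic pairs included in the vector. A new pair anticommutes with the
  earlier terms and contributes only its own square.\<close>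

lemma fermionic_vector_square:
  fixes eg :: "nat \<Rightarrow> 'c::real_algebra_1"
  assumes cw: "clifford_weyl n e eg" and "i \<le> n"
  shows "fermionic_vector i eg ^ 2 = sym_square i"
  using \<open>i \<le> n\<close>
proof (induction i)
  case 0
  then show ?case by (simp add: fermionic_vector_def sym_square_def)
next
  case (Suc i)
  define v where "v j = grassmann_var j * grassmann_const (eg j)" for j
  \<comment> \<open>Anticommuting variables times commuting generators give anticommuting
    products.\<close>
  have anti: "v j * v k + v k * v j = 0" if "eg j * eg k = eg k * eg j" for j k
    unfolding v_def var_const_mult that
    by (subst grassmann_var_anticommute) simp
  \<comment> \<open>The new pair index \<open>Suc i\<close> differs from every earlier one, so the
    \<open>of_bool\<close> in the mixed odd-even relation vanishes.\<close>
  have comm: "eg j * eg (2 * i + 1) = eg (2 * i + 1) * eg j \<and>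
      eg j * eg (2 * i + 2) = eg (2 * i + 2) * eg j" if "j \<in> {1..2 * i}" for j
  proof -
    have i: "Suc i \<in> {1..n}" using Suc.prems by auto
    show ?thesis
    proof (cases "even j")
      case True
      then obtain l where "j = 2 * l" by blast
      moreover from this have "l \<in> {1..n}" "l \<noteq> Suc i" using that Suc.prems by auto
      ultimately show ?thesis
        using clifford_weyl_symp[OF cw i, of l] clifford_weyl_symp[OF cw _ i, of l] by simp
    next
      case False
      then obtain l where "j = 2 * Suc l - 1" by (auto elim: oddE)
      moreover from this have "Suc l \<in> {1..n}" "Suc l \<noteq> Suc i" using that Suc.prems by auto
      ultimately show ?thesis
        using clifford_weyl_symp[OF cw _ i, of "Suc l"] by simp
    qed
  qed
  define u where "u = v (2 * i + 1) + v (2 * i + 2)"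
  let ?V = "fermionic_vector i eg"
  have V: "?V = (\<Sum>j = 1..2 * i. v j)" by (simp add: fermionic_vector_def v_def)
  have "?V * u + u * ?V = (\<Sum>j = 1..2 * i. (v j * v (2 * i + 1) + v (2 * i + 1) * v j)
      + (v j * v (2 * i + 2) + v (2 * i + 2) * v j))"
    unfolding V u_def
    by (simp add: distrib_left distrib_right sum_distrib_left sum_distrib_right sum.distrib algebra_simps)
  also have "\<dots> = 0"
    using anti comm by (intro sum.neutral) simp
  finally have cross: "?V * u + u * ?V = 0" .
  have vv: "v j * v j = 0" for j
    unfolding v_def var_const_mult grassmann_var_square by simp
  have "u * u = v (2 * i + 1) * v (2 * i + 2) + v (2 * i + 2) * v (2 * i + 1)"
    by (simp add: u_def distrib_left distrib_right vv)
  \<comment> \<open>Swapping the variables in the second product turns the sum into the commutator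
    of the two generators of the new pair, which is 1.\<close>
  also have "\<dots> = grassmann_var (2 * i + 1) * grassmann_var (2 * i + 2) *
      grassmann_const (eg (2 * i + 1) * eg (2 * i + 2) - eg (2 * i + 2) * eg (2 * i + 1))"
    unfolding v_def var_const_mult grassmann_const_diff
    by (subst (2) grassmann_var_anticommute) (simp add: right_diff_distrib)
  also have "eg (2 * i + 1) * eg (2 * i + 2) - eg (2 * i + 2) * eg (2 * i + 1) = 1"
    using clifford_weyl_odd_even[OF cw, of "Suc i" "Suc i"] Suc.prems by simp
  finally have uu: "u * u = grassmann_var (2 * i + 1) * grassmann_var (2 * i + 2)"
    by (simp add: grassmann_const_1)
  have "fermionic_vector (Suc i) eg = ?V + u"
    by (simp add: fermionic_vector_Suc u_def v_def)
  then have "fermionic_vector (Suc i) eg ^ 2 = ?V ^ 2 + (?V * u + u * ?V) + u * u"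
    by (simp add: power2_eq_square algebra_simps)
  then show ?case
    using Suc by (simp add: cross uu sym_square_Suc)
qed

section \<open>Powers of the symplectic square\<close>

lemma sym_square_commute_var: "grassmann_var j * sym_square n = sym_square n * grassmann_var j"
  by (simp add: sym_square_def sum_distrib_left sum_distrib_right grassmann_var_mult_pair)

lemma sym_square_commute_pair:
  "sym_square n * (grassmann_var j * grassmann_var k) = grassmann_var j * grassmann_var k * sym_square n"
  by (metis sym_square_commute_var mult.assoc)

text \<open>The binomial expansion stops after the term linear in \<open>y\<close>, because
  \<open>y\<close> commutes with \<open>t\<close> and squares to zero.\<close>

lemma power_add_square_zero:
  fixes t y :: "'a::real_algebra_1"
  assumes "t * y = y * t" "y * y = 0"
  shows "(t + y) ^ Suc s = t ^ Suc s + real (Suc s) *\<^sub>R (t ^ s * y)"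
proof (induction s)
  case 0
  then show ?case by simp
next
  case (Suc s)
  have 1: "y * t ^ r = t ^ r * y" for r
    by (rule power_commuting_commutes[symmetric]) (rule assms(1))
  have "(t + y) ^ Suc (Suc s) = (t + y) * (t ^ Suc s + real (Suc s) *\<^sub>R (t ^ s * y))"
    by (subst power_Suc) (simp only: Suc)
  also have "\<dots> = t ^ Suc (Suc s) + real (Suc s) *\<^sub>R (t ^ Suc s * y) + y * t ^ Suc s
      + real (Suc s) *\<^sub>R (y * t ^ s * y)"
    by (simp add: distrib_left distrib_right mult.assoc scaleR_add_right)
  also have "y * t ^ s * y = 0"
    by (simp add: 1 mult.assoc assms(2))
  finally show ?case
    unfolding 1[of "Suc s"] of_nat_Suc[of "Suc s"] scaleR_add_left by (simp del: power_Suc of_nat_Suc)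
qed

text \<open>Both claims go through the induction together: the vanishing of the power
  \<open>Suc n\<close> removes the first binomial term, leaving \<open>Suc n\<close> times the
  \<open>n\<close>-th power times the new pair.\<close>

lemma sym_square_top_power:
  "(sym_square n :: 'c::real_algebra_1 grassmann) ^ n = fact n *\<^sub>R prod_list (map grassmann_var [1..<2 * n + 1]) \<and>
   (sym_square n :: 'c grassmann) ^ Suc n = 0"
proof (induction n)
  case 0
  then show ?case by (simp add: sym_square_def)
next
  case (Suc n)
  define y :: "'c grassmann" where "y = grassmann_var (2 * n + 1) * grassmann_var (2 * n + 2)"
  have yy: "y * y = 0"
    unfolding y_def
    by (subst mult.assoc, subst grassmann_var_mult_pair)
      (simp add: mult.assoc grassmann_var_square)
  have comm: "sym_square n * y = y * sym_square n"
    unfolding y_def by (rule sym_square_commute_pair)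
  have pw: "sym_square (Suc n) ^ Suc s = sym_square n ^ Suc s + real (Suc s) *\<^sub>R (sym_square n ^ s * y)" for s
    unfolding sym_square_Suc y_def[symmetric] by (rule power_add_square_zero[OF comm yy])
  have "(prod_list (map grassmann_var [1..<2 * Suc n + 1]) :: 'c grassmann)
      = prod_list (map grassmann_var [1..<2 * n + 1]) * y"
    by (simp add: y_def mult.assoc)
  then have "(sym_square (Suc n) :: 'c grassmann) ^ Suc n
      = fact (Suc n) *\<^sub>R prod_list (map grassmann_var [1..<2 * Suc n + 1])"
    unfolding pw using Suc by (simp del: power_Suc upt_Suc of_nat_Suc add: fact_Suc)
  moreover have "(sym_square (Suc n) :: 'c grassmann) ^ Suc (Suc n) = 0"
    unfolding pw using Suc by (simp add: power_Suc[of _ "Suc n"] del: power_Suc)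
  ultimately show ?case by blast
qed

subsection \<open>The fermionic Laplace operator on powers of the symplectic square\<close>

text \<open>\<open>fermionic_laplace\<close> acts on the values of a functional; this is the
  operator on those values, so the computation stays free of distributions.\<close>

definition grassmann_laplace :: "nat \<Rightarrow> 'c::real_algebra_1 grassmann \<Rightarrow> 'c grassmann"
  where "grassmann_laplace n F =
    4 *\<^sub>R (\<Sum>j = 1..n. grassmann_deriv (2 * j - 1) (grassmann_deriv (2 * j) F))"

text \<open>The degree operator, grouped by symplectic pairs to match the sum in the Laplace
  operator.\<close>

definition grassmann_euler :: "nat \<Rightarrow> 'c::real_algebra_1 grassmann \<Rightarrow> 'c grassmann"
  where "grassmann_euler n F = (\<Sum>j = 1..n. grassmann_var (2 * j - 1) * grassmann_deriv (2 * j - 1) F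
    + grassmann_var (2 * j) * grassmann_deriv (2 * j) F)"

lemma grassmann_deriv_pair_mult:
  "grassmann_deriv i (grassmann_var j * grassmann_var k * F) =
     (if i = j then grassmann_var k * F else 0) - (if i = k then grassmann_var j * F else 0)
     + grassmann_var j * grassmann_var k * grassmann_deriv i F"
  by (simp add: mult.assoc grassmann_deriv_var_mult right_diff_distrib)

text \<open>Only the pair containing the variable is hit by the derivative. The signs differ because
  the even variable is the second factor of its pair.\<close>

lemma grassmann_deriv_sym_square_mult:
  assumes "j \<in> {1..n}"
  shows grassmann_deriv_even_sym_square_mult: "grassmann_deriv (2 * j) (sym_square n * F)
      = sym_square n * grassmann_deriv (2 * j) F - grassmann_var (2 * j - 1) * F"
    and grassmann_deriv_odd_sym_square_mult: "grassmann_deriv (2 * j - 1) (sym_square n * F)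
      = sym_square n * grassmann_deriv (2 * j - 1) F + grassmann_var (2 * j) * F"
proof -
  \<comment> \<open>With truncated subtraction the odd and even indices would coincide at 0, so
    positivity matters here.\<close>
  have par: "2 * j = 2 * i - 1 \<longleftrightarrow> False" "2 * j - 1 = 2 * i \<longleftrightarrow> False"
    "2 * j - 1 = 2 * i - 1 \<longleftrightarrow> j = i" if "i \<in> {1..n}" for i
    using assms that by auto presburger+
  have "grassmann_deriv (2 * j) (sym_square n * F)
      = (\<Sum>i = 1..n. grassmann_var (2 * i - 1) * grassmann_var (2 * i) * grassmann_deriv (2 * j) F
          - (if j = i then grassmann_var (2 * i - 1) * F else 0))"
    unfolding sym_square_def sum_distrib_right grassmann_deriv_linear_simps
    by (intro sum.cong refl) (simp only: grassmann_deriv_pair_mult par if_False if_True split: if_split, simp)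
  then show "grassmann_deriv (2 * j) (sym_square n * F)
      = sym_square n * grassmann_deriv (2 * j) F - grassmann_var (2 * j - 1) * F"
    using assms by (simp add: sum_subtractf sym_square_def sum_distrib_right)
  have "grassmann_deriv (2 * j - 1) (sym_square n * F)
      = (\<Sum>i = 1..n. grassmann_var (2 * i - 1) * grassmann_var (2 * i) * grassmann_deriv (2 * j - 1) F
          + (if j = i then grassmann_var (2 * i) * F else 0))"
    unfolding sym_square_def sum_distrib_right grassmann_deriv_linear_simps
    by (intro sum.cong refl) (simp only: grassmann_deriv_pair_mult par if_False diff_zero add_ac)
  then show "grassmann_deriv (2 * j - 1) (sym_square n * F)
      = sym_square n * grassmann_deriv (2 * j - 1) F + grassmann_var (2 * j) * F"
    using assms by (simp add: sum.distrib sym_square_def sum_distrib_right)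
qed

text \<open>For each pair, the two first-order cross terms form its share of the Euler operator, and
  differentiating the factor \<open>grassmann_var (2 * j - 1)\<close> left by the inner derivative
  yields \<open>- F\<close>.\<close>

lemma grassmann_laplace_sym_square_mult:
  "grassmann_laplace n (sym_square n * F)
     = sym_square n * grassmann_laplace n F + 4 *\<^sub>R grassmann_euler n F - (4 * real n) *\<^sub>R F"
proof -
  have "grassmann_deriv (2 * j - 1) (grassmann_deriv (2 * j) (sym_square n * F))
      = sym_square n * grassmann_deriv (2 * j - 1) (grassmann_deriv (2 * j) F)
        + (grassmann_var (2 * j - 1) * grassmann_deriv (2 * j - 1) F
            + grassmann_var (2 * j) * grassmann_deriv (2 * j) F) - F"
    if "j \<in> {1..n}" for j
    unfolding grassmann_deriv_even_sym_square_mult[OF that] grassmann_deriv_linear_simps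
      grassmann_deriv_odd_sym_square_mult[OF that] grassmann_deriv_var_mult
    by simp
  then have "(\<Sum>j = 1..n. grassmann_deriv (2 * j - 1) (grassmann_deriv (2 * j) (sym_square n * F)))
      = sym_square n * (\<Sum>j = 1..n. grassmann_deriv (2 * j - 1) (grassmann_deriv (2 * j) F))
        + grassmann_euler n F - real n *\<^sub>R F"
    by (simp add: sum_subtractf sum.distrib sum_distrib_left grassmann_euler_def
      sum_constant_scaleR del: sum_constant)
  then show ?thesis
    unfolding grassmann_laplace_def by (simp add: scaleR_add_right scaleR_diff_right)
qed

text \<open>The Euler operator is a derivation and \<open>sym_square n\<close> is even of degree 2:
  each variable of a pair reproduces that pair once, the sign for the even one being undone by
  reordering.\<close>

lemma grassmann_euler_sym_square_mult:
  "grassmann_euler n (sym_square n * F) = sym_square n * grassmann_euler n F + 2 *\<^sub>R (sym_square n * F)"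
proof -
  define E where "E j = grassmann_var (2 * j - 1) * grassmann_deriv (2 * j - 1) F
    + grassmann_var (2 * j) * grassmann_deriv (2 * j) F" for j
  define Q where "Q j = grassmann_var (2 * j - 1) * (grassmann_var (2 * j) :: 'a grassmann)" for j
  have step: "grassmann_var (2 * j - 1) * grassmann_deriv (2 * j - 1) (sym_square n * F)
        + grassmann_var (2 * j) * grassmann_deriv (2 * j) (sym_square n * F)
      = sym_square n * E j + 2 *\<^sub>R (Q j * F)"
    if "j \<in> {1..n}" for j
  proof -
    have comm: "grassmann_var i * (sym_square n * G) = sym_square n * (grassmann_var i * G)"
      for i and G :: "'a grassmann"
      by (metis sym_square_commute_var mult.assoc)
    have "grassmann_var (2 * j) * (grassmann_var (2 * j - 1) * F)
        = - (grassmann_var (2 * j - 1) * grassmann_var (2 * j) * F)"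
      by (subst mult.assoc[symmetric], subst grassmann_var_anticommute) simp
    then show ?thesis
      unfolding grassmann_deriv_even_sym_square_mult[OF that] E_def Q_def
        grassmann_deriv_odd_sym_square_mult[OF that] distrib_left right_diff_distrib comm
      by (simp add: scaleR_2 mult.assoc)
  qed
  have "grassmann_euler n (sym_square n * F) = (\<Sum>j = 1..n. sym_square n * E j + 2 *\<^sub>R (Q j * F))"
    unfolding grassmann_euler_def by (intro sum.cong refl step)
  also have "\<dots> = sym_square n * (\<Sum>j = 1..n. E j) + 2 *\<^sub>R ((\<Sum>j = 1..n. Q j) * F)"
    by (simp only: sum.distrib sum_distrib_left sum_distrib_right scaleR_sum_right)
  finally show ?thesis
    by (simp only: E_def Q_def flip: grassmann_euler_def sym_square_def)
qed

lemma grassmann_euler_sym_square_power: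
  "grassmann_euler n (sym_square n ^ s) = (2 * real s) *\<^sub>R sym_square n ^ s"
proof (induction s)
  case 0
  then show ?case by (simp add: grassmann_euler_def grassmann_deriv_1)
next
  case (Suc s)
  then show ?case
    by (simp add: grassmann_euler_sym_square_mult flip: scaleR_add_left)
qed

text \<open>The commutation formula adds \<open>8 * real (Suc s) - 4 * real n\<close> to the
  coefficient at each step. The last factor is a real difference, free of truncation.\<close>

lemma grassmann_laplace_sym_square_power:
  "grassmann_laplace n (sym_square n ^ Suc s)
     = (- 4 * real (Suc s) * (real n - real s)) *\<^sub>R (sym_square n :: 'c::real_algebra_1 grassmann) ^ s"
proof (induction s)
  case 0
  have "grassmann_laplace n (sym_square n * 1) = (- 4 * real n) *\<^sub>R (1 :: 'c grassmann)"
    unfolding grassmann_laplace_sym_square_mult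
    by (simp add: grassmann_laplace_def grassmann_euler_def grassmann_deriv_1 linear_0[OF linear_grassmann_deriv])
  then show ?case by simp
next
  case (Suc s)
  have "grassmann_laplace n ((sym_square n :: 'c grassmann) ^ Suc (Suc s))
      = sym_square n * (- 4 * real (Suc s) * (real n - real s)) *\<^sub>R sym_square n ^ s
        + 4 *\<^sub>R (2 * real (Suc s)) *\<^sub>R sym_square n ^ Suc s - (4 * real n) *\<^sub>R sym_square n ^ Suc s"
    by (subst power_Suc) (simp only: grassmann_laplace_sym_square_mult Suc grassmann_euler_sym_square_power)
  also have "\<dots> = (- 4 * real (Suc s) * (real n - real s) + 8 * real (Suc s) - 4 * real n) *\<^sub>R
      sym_square n ^ Suc s"
    by (simp add: scaleR_add_left scaleR_diff_left del: of_nat_Suc)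
  also have "- 4 * real (Suc s) * (real n - real s) + 8 * real (Suc s) - 4 * real n
      = - 4 * real (Suc (Suc s)) * (real n - real (Suc s))"
    by (simp add: algebra_simps)
  finally show ?case .
qed

lemma linear_grassmann_laplace: "linear (grassmann_laplace n)"
  unfolding grassmann_laplace_def
  by (rule linearI)
    (simp_all add: grassmann_deriv_add grassmann_deriv_scaleR sum.distrib scaleR_add_right scaleR_sum_right mult.commute)

section \<open>Membership in the Grassmann algebra on finitely many variables\<close>

lemma grassmann_on_1: "1 \<in> grassmann_on N"
  by (simp add: grassmann_on_def one_grassmann.rep_eq)

lemma grassmann_on_add: "F \<in> grassmann_on N \<Longrightarrow> G \<in> grassmann_on N \<Longrightarrow> F + G \<in> grassmann_on N"
  unfolding grassmann_on_def plus_grassmann.rep_eq mem_Collect_eq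
  by (metis add_0)

lemma grassmann_on_0: "0 \<in> grassmann_on N"
  by (simp add: grassmann_on_def zero_grassmann.rep_eq)

lemma grassmann_on_sum: "(\<And>i. i \<in> I \<Longrightarrow> F i \<in> grassmann_on N) \<Longrightarrow> sum F I \<in> grassmann_on N"
  by (induction I rule: infinite_finite_induct) (simp_all add: grassmann_on_0 grassmann_on_add)

lemma grassmann_on_mult:
  assumes "F \<in> grassmann_on N" "G \<in> grassmann_on N"
  shows "F * G \<in> grassmann_on N"
  unfolding grassmann_on_def
proof (intro CollectI allI impI)
  fix A assume "gcoeff (F * G) A \<noteq> 0"
  then obtain B where "B \<in> Pow A" "shuffle_sign B (A - B) *\<^sub>R (gcoeff F B * gcoeff G (A - B)) \<noteq> 0"
    unfolding times_grassmann.rep_eq by (meson sum.not_neutral_contains_not_neutral)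
  then have "B \<subseteq> A" "gcoeff F B \<noteq> 0" "gcoeff G (A - B) \<noteq> 0" by auto
  then have "B \<subseteq> {1..N}" "A - B \<subseteq> {1..N}" using assms unfolding grassmann_on_def by blast+
  then show "A \<subseteq> {1..N}" by blast
qed

lemma grassmann_on_var: "j \<in> {1..N} \<Longrightarrow> grassmann_var j \<in> grassmann_on N"
  by (simp add: grassmann_on_def grassmann_var.rep_eq)

lemma grassmann_on_scaleR: "F \<in> grassmann_on N \<Longrightarrow> c *\<^sub>R F \<in> grassmann_on N"
  by (simp add: grassmann_on_def scaleR_grassmann.rep_eq)

text \<open>\<open>super_distribution\<close> requires the second tensor factors to lie in this
  subalgebra.\<close>

lemma grassmann_on_sym_square_power: "(sym_square n :: 'a::real_algebra_1 grassmann) ^ s \<in> grassmann_on (2 * n)"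
proof (induction s)
  case 0
  then show ?case by (simp add: grassmann_on_1)
next
  case (Suc s)
  have "(sym_square n :: 'a grassmann) \<in> grassmann_on (2 * n)"
    unfolding sym_square_def by (intro grassmann_on_sum grassmann_on_mult grassmann_on_var) auto
  with Suc show ?case by (simp add: grassmann_on_mult)
qed

subsection \<open>The recursion in the exponent of the super operator\<close>

lemma foldr_dist_deriv_sum_tensor:
  "foldr dist_deriv w (\<lambda>\<phi>. \<Sum>i\<in>I. (T i \<otimes>\<^sub>D v i) \<phi>) = (\<lambda>\<phi>. \<Sum>i\<in>I. (foldr dist_deriv w (T i) \<otimes>\<^sub>D v i) \<phi>)"
  by (induction w) (simp_all add: dist_deriv_def tensor_def fun_eq_iff sum_negf)

text \<open>The operator only alters the test function, so the second tensor factors pass through as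
  constants and the sums over words and over terms may be exchanged.\<close>

lemma pdo_sum_tensor:
  "pdo d a (\<lambda>\<phi>. \<Sum>i\<in>I. (T i \<otimes>\<^sub>D v i) \<phi>) = (\<lambda>\<phi>. \<Sum>i\<in>I. (pdo d a (T i) \<otimes>\<^sub>D v i) \<phi>)"
proof
  fix \<phi>
  have "pdo d a (\<lambda>\<phi>. \<Sum>i\<in>I. (T i \<otimes>\<^sub>D v i) \<phi>) \<phi>
      = (\<Sum>w | length w \<le> d. \<Sum>i\<in>I. dist_mult (a w) (foldr dist_deriv w (T i)) \<phi> *\<^sub>R v i)"
    unfolding pdo_def foldr_dist_deriv_sum_tensor by (simp add: dist_mult_def tensor_def)
  also have "\<dots> = (\<Sum>i\<in>I. \<Sum>w | length w \<le> d. dist_mult (a w) (foldr dist_deriv w (T i)) \<phi> *\<^sub>R v i)"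
    by (rule sum.swap)
  finally show "pdo d a (\<lambda>\<phi>. \<Sum>i\<in>I. (T i \<otimes>\<^sub>D v i) \<phi>) \<phi> = (\<Sum>i\<in>I. (pdo d a (T i) \<otimes>\<^sub>D v i) \<phi>)"
    by (simp add: tensor_def pdo_def scaleR_sum_left)
qed

text \<open>Writing \<open>(l + k - 1)! / (k - 1)!\<close> as a Pochhammer symbol extends the formula to \<open>k = 0\<close>,
  where only the term \<open>l = 0\<close> survives.\<close>

definition super_solution :: "nat \<Rightarrow> (nat \<Rightarrow> 'm::finite test_fun \<Rightarrow> real) \<Rightarrow> nat \<Rightarrow>
    'm test_fun \<Rightarrow> 'c::real_algebra_1 grassmann"
  where "super_solution n \<nu> k = (\<lambda>\<phi>. \<Sum>l\<le>n.
    (\<nu> (l + k) \<otimes>\<^sub>D (4 ^ l * pochhammer (real k) l / fact (n - l)) *\<^sub>R sym_square n ^ (n - l)) \<phi>)"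

text \<open>After applying \<open>L\<close>, the summand with index \<open>Suc l\<close> meets the
  Laplace image of the summand with index \<open>l\<close>: both carry
  \<open>\<nu> (Suc l + k)\<close> and the same power of \<open>sym_square n\<close>.\<close>

lemma super_pdo_super_solution:
  fixes \<nu> :: "nat \<Rightarrow> 'm::finite test_fun \<Rightarrow> real"
  assumes \<nu>: "\<And>j. pdo d a (\<nu> (Suc j)) = \<nu> j"
  shows "super_pdo n d a (super_solution n \<nu> (Suc k)) =
    (super_solution n \<nu> k :: 'm test_fun \<Rightarrow> 'c::real_algebra_1 grassmann)"
proof
  fix \<phi>
  let ?S = "super_solution n \<nu> :: nat \<Rightarrow> 'm test_fun \<Rightarrow> 'c grassmann"
  define c where "c k l = 4 ^ l * pochhammer (real k) l / fact (n - l)" for k l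
  define t where "t l = \<nu> (l + k) \<phi> *\<^sub>R (sym_square n :: 'c grassmann) ^ (n - l)" for l
  have L: "pdo d a (?S (Suc k)) \<phi> = (\<Sum>l\<le>n. c (Suc k) l *\<^sub>R t l)"
    unfolding super_solution_def pdo_sum_tensor by (simp add: \<nu> tensor_def c_def t_def mult.commute)
  have "fermionic_laplace n (?S (Suc k)) \<phi>
      = grassmann_laplace n (?S (Suc k) \<phi>)"
    by (simp add: fermionic_laplace_def grassmann_laplace_def)
  also have "\<dots> = (\<Sum>l\<le>n. (\<nu> (l + Suc k) \<phi> * c (Suc k) l) *\<^sub>R grassmann_laplace n (sym_square n ^ (n - l)))"
    by (simp add: super_solution_def tensor_def c_def linear_sum[OF linear_grassmann_laplace]
        linear_scale[OF linear_grassmann_laplace])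
  \<comment> \<open>The summand \<open>l = n\<close> carries the power 0, a constant, which the
    Laplace operator annihilates.\<close>
  also have "\<dots> = (\<Sum>l<n. (\<nu> (l + Suc k) \<phi> * c (Suc k) l) *\<^sub>R grassmann_laplace n (sym_square n ^ (n - l)))"
    by (simp add: lessThan_Suc_atMost[symmetric] grassmann_laplace_def grassmann_deriv_1
        linear_0[OF linear_grassmann_deriv])
  also have "\<dots> = (\<Sum>l<n. (- 4 * real (n - l) * real (Suc l) * c (Suc k) l) *\<^sub>R t (Suc l))"
  proof (rule sum.cong[OF refl])
    fix l assume "l \<in> {..<n}"
    then have "n - l = Suc (n - Suc l)" "real n - real (n - Suc l) = real (Suc l)" by auto
    then show "(\<nu> (l + Suc k) \<phi> * c (Suc k) l) *\<^sub>R grassmann_laplace n (sym_square n ^ (n - l))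
        = (- 4 * real (n - l) * real (Suc l) * c (Suc k) l) *\<^sub>R t (Suc l)"
      by (simp add: grassmann_laplace_sym_square_power t_def del: power_Suc of_nat_Suc)
  qed
  finally have F: "fermionic_laplace n (?S (Suc k)) \<phi>
      = (\<Sum>l<n. (- 4 * real (n - l) * real (Suc l) * c (Suc k) l) *\<^sub>R t (Suc l))" .
  \<comment> \<open>With the common factor \<open>W\<close> below this reads (k + 1 + l) W - (l + 1)
    W = k W. The Pochhammer symbol at \<open>Suc k\<close> is split at its last factor, the one at
    \<open>k\<close> at its first.\<close>
  have c: "c (Suc k) (Suc l) + (- 4 * real (n - l) * real (Suc l) * c (Suc k) l) = c k (Suc l)"
    if "l < n" for l
  proof -
    have "fact (n - l) = real (n - l) * fact (n - Suc l)"
      using that by (metis Suc_diff_Suc fact_Suc)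
    moreover have "real (n - l) \<noteq> 0" using that by simp
    ultimately have "real (n - l) * c (Suc k) l = 4 ^ l * pochhammer (real (Suc k)) l / fact (n - Suc l)"
      by (simp add: c_def)
    moreover define W where "W = 4 ^ Suc l * pochhammer (real (Suc k)) l / fact (n - Suc l)"
    ultimately have W: "4 * (real (n - l) * c (Suc k) l) = W" by simp
    have "c (Suc k) (Suc l) = (real (Suc k) + real l) * W" "c k (Suc l) = real k * W"
      unfolding c_def W_def pochhammer_Suc[of "real (Suc k)"] pochhammer_rec[of "real k"]
      by (simp_all add: add.commute)
    moreover have "- 4 * real (n - l) * real (Suc l) * c (Suc k) l = - real (Suc l) * W"
      unfolding W[symmetric] by (simp add: algebra_simps)
    ultimately show ?thesis by (simp add: algebra_simps)
  qed
  \<comment> \<open>The term with index 0 comes from \<open>L\<close> alone; its coefficient does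
    not depend on \<open>k\<close>.\<close>
  have "super_pdo n d a (?S (Suc k)) \<phi>
      = c (Suc k) 0 *\<^sub>R t 0 + (\<Sum>l<n. c (Suc k) (Suc l) *\<^sub>R t (Suc l)
          + (- 4 * real (n - l) * real (Suc l) * c (Suc k) l) *\<^sub>R t (Suc l))"
    unfolding super_pdo_def L F sum.distrib
    by (simp only: lessThan_Suc_atMost[symmetric] sum.lessThan_Suc_shift add.assoc)
  also have "\<dots> = c k 0 *\<^sub>R t 0 + (\<Sum>l<n. c k (Suc l) *\<^sub>R t (Suc l))"
    by (intro arg_cong2[of _ _ _ _ "(+)"] sum.cong)
      (simp_all only: scaleR_add_left[symmetric] c lessThan_iff, simp add: c_def)
  also have "\<dots> = ?S k \<phi>"
    unfolding super_solution_def lessThan_Suc_atMost[symmetric] sum.lessThan_Suc_shift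
    by (simp add: tensor_def c_def t_def mult.commute)
  finally show "super_pdo n d a (?S (Suc k)) \<phi> = ?S k \<phi>" .
qed

text \<open>The Pochhammer symbol at 0 vanishes for positive \<open>l\<close>, and the remaining top
  power divided by \<open>fact n\<close> is the ordered product of all variables.\<close>

lemma super_solution_0:
  assumes "\<nu> 0 = dirac"
  shows "super_solution n \<nu> 0 = super_dirac n"
proof
  fix \<phi>
  have "super_solution n \<nu> 0 \<phi> = (\<Sum>l\<le>n. if l = 0 then dirac \<phi> *\<^sub>R (1 / fact n) *\<^sub>R sym_square n ^ n else 0)"
    unfolding super_solution_def
    by (intro sum.cong) (auto simp: tensor_def assms pochhammer_0_left)
  then show "super_solution n \<nu> 0 \<phi> = super_dirac n \<phi>"
    by (simp add: super_dirac_def tensor_def conjunct1[OF sym_square_top_power] del: upt_Suc)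
qed

theorem mainTheorem5:
  fixes n k d :: nat
    and a :: "'m::finite list \<Rightarrow> 'm smooth_fun"
    and e :: "'m \<Rightarrow> 'c::real_algebra_1"
    and eg :: "nat \<Rightarrow> 'c"
    and \<mu> :: "nat \<Rightarrow> 'm test_fun \<Rightarrow> real"
  assumes "k \<ge> 1"
    and "clifford_weyl n e eg"
    and "elliptic d a"
    and "\<And>l. l \<ge> 1 \<Longrightarrow> fundamental_solution (pdo d a ^^ l) (\<mu> (2 * l))"
    and "\<And>l j. l \<ge> 1 \<Longrightarrow> j < l \<Longrightarrow> (pdo d a ^^ j) (\<mu> (2 * l)) = \<mu> (2 * l - 2 * j)"
  shows "super_fundamental_solution n (super_pdo n d a ^^ k)
    (\<lambda>\<phi>. \<Sum>l = 0..n. (4 ^ l * (fact (l + k - 1) / (fact (n - l) * fact (k - 1)))) *\<^sub>R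
        (\<mu> (2 * l + 2 * k) \<otimes>\<^sub>D fermionic_vector n eg ^ (2 * n - 2 * l)) \<phi>)"
proof -
  \<comment> \<open>Halving the even indices and placing the Dirac distribution at 0 merges the two
    hypotheses on \<open>\<mu>\<close> into one recursion.\<close>
  define \<nu> where "\<nu> j = (if j = 0 then dirac else \<mu> (2 * j))" for j
  have \<nu>: "pdo d a (\<nu> (Suc j)) = \<nu> j" for j
  proof (cases "j = 0")
    case True
    then show ?thesis using assms(4)[of 1] by (simp add: \<nu>_def fundamental_solution_def)
  next
    case False
    then show ?thesis using assms(5)[of "Suc j" 1] by (simp add: \<nu>_def)
  qed
  \<comment> \<open>Here \<open>k \<ge> 1\<close> keeps \<open>k - 1\<close> from
    truncating.\<close>
  have poch: "pochhammer (real k) l = fact (l + k - 1) / fact (k - 1)" for l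
  proof -
    obtain k' where "k = Suc k'" using assms(1) by (cases k) auto
    moreover have "fact k' * pochhammer (real (Suc k')) l = fact (l + k')"
      by (induction l) (simp_all only: pochhammer_Suc mult.assoc[symmetric], simp_all add: algebra_simps)
    ultimately show ?thesis
      by (simp add: field_simps)
  qed
  have "(4 ^ l * (fact (l + k - 1) / (fact (n - l) * fact (k - 1)))) *\<^sub>R
        (\<mu> (2 * l + 2 * k) \<otimes>\<^sub>D fermionic_vector n eg ^ (2 * n - 2 * l)) \<phi>
      = (\<nu> (l + k) \<otimes>\<^sub>D (4 ^ l * pochhammer (real k) l / fact (n - l)) *\<^sub>R sym_square n ^ (n - l)) \<phi>" for l \<phi>
  proof -
    have "fermionic_vector n eg ^ (2 * n - 2 * l) = sym_square n ^ (n - l)"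
      by (metis diff_mult_distrib2 power_mult fermionic_vector_square[OF assms(2) order_refl])
    then show ?thesis
      using assms(1) by (simp add: \<nu>_def tensor_def poch algebra_simps)
  qed
  then have eq: "(\<lambda>\<phi>. \<Sum>l = 0..n. (4 ^ l * (fact (l + k - 1) / (fact (n - l) * fact (k - 1)))) *\<^sub>R
        (\<mu> (2 * l + 2 * k) \<otimes>\<^sub>D fermionic_vector n eg ^ (2 * n - 2 * l)) \<phi>) = super_solution n \<nu> k"
    by (simp add: super_solution_def atLeast0AtMost)
  \<comment> \<open>Since \<open>l + k \<ge> 1\<close>, the index 0 does not occur and the property
    comes from \<open>fundamental_solution\<close>.\<close>
  have "distribution (\<nu> (l + k))" for l
    using assms(1) assms(4)[of "l + k"] by (simp add: \<nu>_def fundamental_solution_def)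
  then have "super_distribution n (super_solution n \<nu> k :: 'm test_fun \<Rightarrow> 'c grassmann)"
    unfolding super_distribution_def
    by (intro exI[of _ "Suc n"] exI[of _ "\<lambda>l. \<nu> (l + k)"]
        exI[of _ "\<lambda>l. (4 ^ l * pochhammer (real k) l / fact (n - l)) *\<^sub>R sym_square n ^ (n - l)"])
      (simp add: super_solution_def lessThan_Suc_atMost grassmann_on_scaleR grassmann_on_sym_square_power)
  \<comment> \<open>One factor of the power is applied first, lowering the candidate from
    \<open>Suc i\<close> to \<open>i\<close>.\<close>
  moreover have "(super_pdo n d a ^^ i) (super_solution n \<nu> i) = super_dirac n" for i
  proof (induction i)
    case 0
    show ?case by (simp add: super_solution_0 \<nu>_def)
  next
    case (Suc i)
    then show ?case by (simp add: super_pdo_super_solution[where \<nu> = \<nu>, OF \<nu>] funpow_Suc_right del: funpow.simps)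
  qed
  ultimately show ?thesis
    unfolding eq super_fundamental_solution_def by blast
qed

end
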